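(* The functors $\mathrm{K}$ and $\mathrm{C}$ establish a categorical equivalence between $\mathsf{IS}_0$ and $\mathsf{KIS}_0$, with natural isomorphisms $\alpha:\mathrm{Id}\Rightarrow \mathrm{C}\circ\mathrm{K}$ and $\beta:\mathrm{Id}\Rightarrow\mathrm{K}\circ\mathrm{C}$.
   Context: A bounded implicative semilattice is an algebra $(H,\wedge,\to,0,1)$ such that $(H,\wedge)$ is a meet semilattice with least element $0$ and greatest element $1$, and for all $a,b,d$: $a\wedge b\le d$ iff $a\le b\to d$. $\mathsf{IS}_0$ is the category of bounded implicative semilattices and algebra homomorphisms. A Kleene poset is a structure $(T,\le,\sim,c)$ such that: (1) $(T,\le)$ is a poset; (2) $\sim$ is a unary operation with $\sim\sim x=x$, and $x\le y$ implies $\sim y\le\sim x$; (3) $c=\sim c$; (4) $x\vee c$ exists for every $x$ (hence $x\wedge c$ exists and equals $\sim(\sim x\vee c)$); (5) for every $x$, $(x\vee c)\wedge(\sim x\vee c)$ exists and equals $c$; (6) for all $x,y$, if $x\wedge c\le y\wedge c$ and $x\vee c\le y\vee c$ then $x\le y$. Here $\wedge,\vee$ denote infima and suprema in $(T,\le)$. The category $\mathsf{KhIS}_0$ has as objects the structures $(T,\le,\sim,\to,c,0,1)$ such that $(T,\le,\sim,c)$ is a Kleene poset, $0$ is least and $1$ greatest, for all $x,y$ with $x\ge c$ the infimum $x\wedge y$ exists and $(x\wedge y)\vee c=x\wedge(y\vee c)$, and $\to$ is a binary operation on $T$ such that for all $x,y$: (K1) $c\le x\to(y\vee c)$; (K2)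 $x\wedge((x\vee c)\to(y\vee c))\le y\vee c$; (K3) $x\to x=1$; (K4) $(x\to y)\wedge c=(\sim x\wedge c)\vee(y\wedge c)$; (K5) $(x\to\sim y)\vee c=((x\vee c)\to(\sim y\vee c))\wedge((y\vee c)\to(\sim x\vee c))$. Morphisms of $\mathsf{KhIS}_0$ are maps $g$ preserving the order, $\sim$ and $\to$, and such that $g(x\wedge y)=g(x)\wedge g(y)$ for all $x,y\ge c$. $\mathsf{KIS}_0$ is the full subcategory of $\mathsf{KhIS}_0$ whose objects satisfy, for all $x,y,z$: (K6) $x\le(y\vee c)\to((x\vee c)\wedge(y\vee c))$; (K7) $x\to((y\vee c)\wedge(z\vee c))=(x\to(y\vee c))\wedge(x\to(z\vee c))$. For $H\in\mathsf{IS}_0$, $\mathrm{K}(H)=\{(a,b)\in H\times H: a\wedge b=0\}$, with order $(a,b)\preceq(d,e)$ iff $a\le d$ and $e\le b$, $\sim(a,b)=(b,a)$, $c=(0,0)$, $0=(0,1)$, $1=(1,0)$, and $(a,b)\to(d,e)=((a\to d)\wedge(e\to b),\,a\wedge e)$. For a morphism $f$, $\mathrm{K}(f)(a,b)=(f(a),f(b))$. For an object $T$ of $\mathsf{KIS}_0$, $\mathrm{C}(T)=\{x\in T:x\ge c\}$ with the restricted operations $\wedge,\to$, least element $c$ and greatest element $1$; for a morphism $g$, $\mathrm{C}(g)$ is the restriction of $g$. The maps are $\alpha_H:H\to\mathrm{C}(\mathrm{K}(H))$, $\alpha_H(a)=(a,0)$, and $\beta_T:T\to\mathrm{K}(\mathrm{C}(T))$,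 $\beta_T(x)=(x\vee c,\sim x\vee c)$. *)

theory Defs
  imports "HOL-Algebra.Lattice" "HOL-Library.FuncSet"
begin

section \<open>Categories, functors, natural isomorphisms, equivalences\<close>

record ('o, 'm) cat_data =
  Obj :: "'o set"
  Arr :: "'m set"
  Dom :: "'m \<Rightarrow> 'o"
  Cod :: "'m \<Rightarrow> 'o"
  Ident :: "'o \<Rightarrow> 'm"
  Comp :: "'m \<Rightarrow> 'm \<Rightarrow> 'm"    \<comment> \<open>\<open>Comp C g f\<close> is \<open>g\<close> after \<open>f\<close>\<close>

locale category =
  fixes C :: "('o, 'm) cat_data"
  assumes dom_obj: "f \<in> Arr C \<Longrightarrow> Dom C f \<in> Obj C"
    and cod_obj: "f \<in> Arr C \<Longrightarrow> Cod C f \<in> Obj C"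
    and ident_arr: "X \<in> Obj C \<Longrightarrow> Ident C X \<in> Arr C"
    and dom_ident: "X \<in> Obj C \<Longrightarrow> Dom C (Ident C X) = X"
    and cod_ident: "X \<in> Obj C \<Longrightarrow> Cod C (Ident C X) = X"
    and comp_arr: "\<lbrakk>f \<in> Arr C; g \<in> Arr C; Cod C f = Dom C g\<rbrakk> \<Longrightarrow> Comp C g f \<in> Arr C"
    and dom_comp: "\<lbrakk>f \<in> Arr C; g \<in> Arr C; Cod C f = Dom C g\<rbrakk> \<Longrightarrow> Dom C (Comp C g f) = Dom C f"
    and cod_comp: "\<lbrakk>f \<in> Arr C; g \<in> Arr C; Cod C f = Dom C g\<rbrakk> \<Longrightarrow> Cod C (Comp C g f) = Cod C g"
    and comp_ident_right: "f \<in> Arr C \<Longrightarrow> Comp C f (Ident C (Dom C f)) = f"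
    and comp_ident_left: "f \<in> Arr C \<Longrightarrow> Comp C (Ident C (Cod C f)) f = f"
    and comp_assoc:
      "\<lbrakk>f \<in> Arr C; g \<in> Arr C; h \<in> Arr C; Cod C f = Dom C g; Cod C g = Dom C h\<rbrakk>
        \<Longrightarrow> Comp C h (Comp C g f) = Comp C (Comp C h g) f"

definition iso_arrow :: "('o, 'm) cat_data \<Rightarrow> 'm \<Rightarrow> bool" where
  "iso_arrow C f \<longleftrightarrow> f \<in> Arr C \<and>
     (\<exists>g \<in> Arr C. Dom C g = Cod C f \<and> Cod C g = Dom C f \<and>
        Comp C g f = Ident C (Dom C f) \<and> Comp C f g = Ident C (Cod C f))"

definition full_subcat :: "('o, 'm) cat_data \<Rightarrow> ('o \<Rightarrow> bool) \<Rightarrow> ('o, 'm) cat_data" where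
  "full_subcat C P = C\<lparr>Obj := {X \<in> Obj C. P X},
                      Arr := {f \<in> Arr C. P (Dom C f) \<and> P (Cod C f)}\<rparr>"

record ('o, 'm, 'p, 'n) functor_data =
  OMap :: "'o \<Rightarrow> 'p"
  AMap :: "'m \<Rightarrow> 'n"

definition id_functor :: "('o, 'm, 'o, 'm) functor_data" where
  "id_functor = \<lparr>OMap = (\<lambda>X. X), AMap = (\<lambda>f. f)\<rparr>"

definition comp_functor ::
    "('p, 'n, 'q, 'k) functor_data \<Rightarrow> ('o, 'm, 'p, 'n) functor_data
      \<Rightarrow> ('o, 'm, 'q, 'k) functor_data" where
  "comp_functor G F = \<lparr>OMap = OMap G \<circ> OMap F, AMap = AMap G \<circ> AMap F\<rparr>"

locale cat_functor = source: category A + target: category B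
  for A :: "('o, 'm) cat_data" and B :: "('p, 'n) cat_data" +
  fixes F :: "('o, 'm, 'p, 'n) functor_data"
  assumes map_obj: "X \<in> Obj A \<Longrightarrow> OMap F X \<in> Obj B"
    and map_arr: "f \<in> Arr A \<Longrightarrow> AMap F f \<in> Arr B"
    and map_dom: "f \<in> Arr A \<Longrightarrow> Dom B (AMap F f) = OMap F (Dom A f)"
    and map_cod: "f \<in> Arr A \<Longrightarrow> Cod B (AMap F f) = OMap F (Cod A f)"
    and map_ident: "X \<in> Obj A \<Longrightarrow> AMap F (Ident A X) = Ident B (OMap F X)"
    and map_comp: "\<lbrakk>f \<in> Arr A; g \<in> Arr A; Cod A f = Dom A g\<rbrakk>
        \<Longrightarrow> AMap F (Comp A g f) = Comp B (AMap F g) (AMap F f)"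

locale natural_transformation = F: cat_functor A B F + G: cat_functor A B G
  for A :: "('o, 'm) cat_data" and B :: "('p, 'n) cat_data"
    and F G :: "('o, 'm, 'p, 'n) functor_data" +
  fixes \<eta> :: "'o \<Rightarrow> 'n"
  assumes component_arr: "X \<in> Obj A \<Longrightarrow> \<eta> X \<in> Arr B"
    and component_dom: "X \<in> Obj A \<Longrightarrow> Dom B (\<eta> X) = OMap F X"
    and component_cod: "X \<in> Obj A \<Longrightarrow> Cod B (\<eta> X) = OMap G X"
    and naturality: "f \<in> Arr A
        \<Longrightarrow> Comp B (\<eta> (Cod A f)) (AMap F f) = Comp B (AMap G f) (\<eta> (Dom A f))"

locale natural_isomorphism = natural_transformation A B F G \<eta>
  for A :: "('o, 'm) cat_data" and B :: "('p, 'n) cat_data"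
    and F G :: "('o, 'm, 'p, 'n) functor_data" and \<eta> :: "'o \<Rightarrow> 'n" +
  assumes component_iso: "X \<in> Obj A \<Longrightarrow> iso_arrow B (\<eta> X)"

locale category_equivalence =
  F: cat_functor A B F + G: cat_functor B A G +
  unit: natural_isomorphism A A id_functor "comp_functor G F" \<eta> +
  counit: natural_isomorphism B B id_functor "comp_functor F G" \<epsilon>
  for A :: "('o, 'm) cat_data" and B :: "('p, 'n) cat_data"
    and F :: "('o, 'm, 'p, 'n) functor_data" and G :: "('p, 'n, 'o, 'm) functor_data"
    and \<eta> :: "'o \<Rightarrow> 'm" and \<epsilon> :: "'p \<Rightarrow> 'n"

subsection \<open>Categories of structured sets\<close>

record ('o, 'u) arrow =
  src :: 'o
  tgt :: 'o
  fn :: "'u \<Rightarrow> 'u"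

text \<open>
  \<open>U X\<close> is the underlying set of an object \<open>X\<close>. The function of an arrow is
  \<^const>\<open>undefined\<close> outside the underlying set of its source, so that arrows with the same
  source and target are equal iff they agree on that set. The operations of an object are
  not normalised outside its carrier; structures differing only there are different but
  isomorphic objects.
\<close>

definition concrete_cat ::
    "'o set \<Rightarrow> ('o \<Rightarrow> 'u set) \<Rightarrow> ('o \<Rightarrow> 'o \<Rightarrow> ('u \<Rightarrow> 'u) \<Rightarrow> bool)
      \<Rightarrow> ('o, ('o, 'u) arrow) cat_data" where
  "concrete_cat Ob U hm =
     \<lparr>Obj = Ob,
      Arr = {f. src f \<in> Ob \<and> tgt f \<in> Ob \<and> fn f \<in> U (src f) \<rightarrow>\<^sub>E U (tgt f)
                \<and> hm (src f) (tgt f) (fn f)},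
      Dom = src,
      Cod = tgt,
      Ident = (\<lambda>X. \<lparr>src = X, tgt = X, fn = (\<lambda>x\<in>U X. x)\<rparr>),
      Comp = (\<lambda>g f. \<lparr>src = src f, tgt = tgt g, fn = compose (U (src f)) (fn g) (fn f)\<rparr>)\<rparr>"


section \<open>Bounded implicative semilattices\<close>

record 'u isl = "'u partial_object" +
  imeet :: "'u \<Rightarrow> 'u \<Rightarrow> 'u"
  iimp :: "'u \<Rightarrow> 'u \<Rightarrow> 'u"
  izero :: 'u
  ione :: 'u

definition isl_le :: "('u, 'b) isl_scheme \<Rightarrow> 'u \<Rightarrow> 'u \<Rightarrow> bool" where
  "isl_le H a b \<longleftrightarrow> imeet H a b = a"

locale bounded_implicative_semilattice =
  fixes H :: "('u, 'b) isl_scheme"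
  assumes meet_closed: "\<lbrakk>a \<in> carrier H; b \<in> carrier H\<rbrakk> \<Longrightarrow> imeet H a b \<in> carrier H"
    and imp_closed: "\<lbrakk>a \<in> carrier H; b \<in> carrier H\<rbrakk> \<Longrightarrow> iimp H a b \<in> carrier H"
    and zero_closed: "izero H \<in> carrier H"
    and one_closed: "ione H \<in> carrier H"
    and meet_assoc: "\<lbrakk>a \<in> carrier H; b \<in> carrier H; d \<in> carrier H\<rbrakk>
        \<Longrightarrow> imeet H (imeet H a b) d = imeet H a (imeet H b d)"
    and meet_comm: "\<lbrakk>a \<in> carrier H; b \<in> carrier H\<rbrakk> \<Longrightarrow> imeet H a b = imeet H b a"
    and meet_idem: "a \<in> carrier H \<Longrightarrow> imeet H a a = a"
    and zero_least: "a \<in> carrier H \<Longrightarrow> isl_le H (izero H) a"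
    and one_greatest: "a \<in> carrier H \<Longrightarrow> isl_le H a (ione H)"
    and residuation: "\<lbrakk>a \<in> carrier H; b \<in> carrier H; d \<in> carrier H\<rbrakk>
        \<Longrightarrow> isl_le H (imeet H a b) d \<longleftrightarrow> isl_le H a (iimp H b d)"

definition isl_hom :: "'u isl \<Rightarrow> 'u isl \<Rightarrow> ('u \<Rightarrow> 'u) \<Rightarrow> bool" where
  "isl_hom H H' f \<longleftrightarrow>
     (\<forall>a \<in> carrier H. \<forall>b \<in> carrier H. f (imeet H a b) = imeet H' (f a) (f b)) \<and>
     (\<forall>a \<in> carrier H. \<forall>b \<in> carrier H. f (iimp H a b) = iimp H' (f a) (f b)) \<and>
     f (izero H) = izero H' \<and> f (ione H) = ione H'"

definition IS0 :: "('u isl, ('u isl, 'u) arrow) cat_data" where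
  "IS0 = concrete_cat {H. bounded_implicative_semilattice H} carrier isl_hom"


section \<open>Kleene posets and the categories \<open>KhIS0\<close> and \<open>KIS0\<close>\<close>

record 'u kleene = "'u gorder" +
  neg :: "'u \<Rightarrow> 'u" (\<open>\<sim>\<index>_\<close> [91] 90)
  centre :: 'u (\<open>\<c>\<index>\<close>)

record 'u khis = "'u kleene" +
  kimp :: "'u \<Rightarrow> 'u \<Rightarrow> 'u" (infixr \<open>\<leadsto>\<index>\<close> 60)
  kzero :: 'u
  kone :: 'u

text \<open>
  \<open>\<squnion>\<close> and \<open>\<sqinter>\<close> are the library's binary suprema and infima, chosen by Hilbert's operator and
  hence only meaningful when they exist. Where existence is part of an axiom it is stated
  with \<^const>\<open>least\<close> and \<^const>\<open>greatest\<close>.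
\<close>

locale kleene_poset = partial_order T for T :: "('u, 'b) kleene_scheme" (structure) +
  assumes neg_closed: "x \<in> carrier T \<Longrightarrow> \<sim>x \<in> carrier T"
    and centre_closed: "\<c> \<in> carrier T"
    and neg_neg: "x \<in> carrier T \<Longrightarrow> \<sim>(\<sim>x) = x"
    and neg_antitone: "\<lbrakk>x \<in> carrier T; y \<in> carrier T; x \<sqsubseteq> y\<rbrakk> \<Longrightarrow> \<sim>y \<sqsubseteq> \<sim>x"
    and centre_neg: "\<c> = \<sim>\<c>"
    and join_centre_exists: "x \<in> carrier T \<Longrightarrow> \<exists>s. least T s (Upper T {x, \<c>})"
    and centre_inf: "x \<in> carrier T \<Longrightarrow> greatest T \<c> (Lower T {x \<squnion> \<c>, \<sim>x \<squnion> \<c>})"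
    and order_determined:
      "\<lbrakk>x \<in> carrier T; y \<in> carrier T; x \<sqinter> \<c> \<sqsubseteq> y \<sqinter> \<c>; x \<squnion> \<c> \<sqsubseteq> y \<squnion> \<c>\<rbrakk> \<Longrightarrow> x \<sqsubseteq> y"

text \<open>
  All infima and suprema below exist by the axioms up to and including \<open>K1\<close>: each infimum
  has an argument above \<open>\<c>\<close> or has \<open>\<c>\<close> as an argument, and the supremum in \<open>K4\<close> is dual to
  \<open>(x \<squnion> \<c>) \<sqinter> (\<sim>y \<squnion> \<c>)\<close>.
\<close>

locale khis0 = kleene_poset T for T :: "('u, 'b) khis_scheme" (structure) +
  assumes kzero_closed: "kzero T \<in> carrier T"
    and kone_closed: "kone T \<in> carrier T"
    and kzero_least: "x \<in> carrier T \<Longrightarrow> kzero T \<sqsubseteq> x"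
    and kone_greatest: "x \<in> carrier T \<Longrightarrow> x \<sqsubseteq> kone T"
    and meet_exists: "\<lbrakk>x \<in> carrier T; y \<in> carrier T; \<c> \<sqsubseteq> x\<rbrakk>
        \<Longrightarrow> \<exists>i. greatest T i (Lower T {x, y})"
    and meet_join_centre: "\<lbrakk>x \<in> carrier T; y \<in> carrier T; \<c> \<sqsubseteq> x\<rbrakk>
        \<Longrightarrow> (x \<sqinter> y) \<squnion> \<c> = x \<sqinter> (y \<squnion> \<c>)"
    and kimp_closed: "\<lbrakk>x \<in> carrier T; y \<in> carrier T\<rbrakk> \<Longrightarrow> x \<leadsto> y \<in> carrier T"
    and K1: "\<lbrakk>x \<in> carrier T; y \<in> carrier T\<rbrakk> \<Longrightarrow> \<c> \<sqsubseteq> (x \<leadsto> (y \<squnion> \<c>))"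
    and K2: "\<lbrakk>x \<in> carrier T; y \<in> carrier T\<rbrakk>
        \<Longrightarrow> x \<sqinter> ((x \<squnion> \<c>) \<leadsto> (y \<squnion> \<c>)) \<sqsubseteq> y \<squnion> \<c>"
    and K3: "x \<in> carrier T \<Longrightarrow> (x \<leadsto> x) = kone T"
    and K4: "\<lbrakk>x \<in> carrier T; y \<in> carrier T\<rbrakk>
        \<Longrightarrow> (x \<leadsto> y) \<sqinter> \<c> = (\<sim>x \<sqinter> \<c>) \<squnion> (y \<sqinter> \<c>)"
    and K5: "\<lbrakk>x \<in> carrier T; y \<in> carrier T\<rbrakk>
        \<Longrightarrow> (x \<leadsto> \<sim>y) \<squnion> \<c> = ((x \<squnion> \<c>) \<leadsto> (\<sim>y \<squnion> \<c>)) \<sqinter> ((y \<squnion> \<c>) \<leadsto> (\<sim>x \<squnion> \<c>))"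

definition khis_hom :: "'u khis \<Rightarrow> 'u khis \<Rightarrow> ('u \<Rightarrow> 'u) \<Rightarrow> bool" where
  "khis_hom T T' g \<longleftrightarrow>
     (\<forall>x \<in> carrier T. \<forall>y \<in> carrier T. x \<sqsubseteq>\<^bsub>T\<^esub> y \<longrightarrow> g x \<sqsubseteq>\<^bsub>T'\<^esub> g y) \<and>
     (\<forall>x \<in> carrier T. g (\<sim>\<^bsub>T\<^esub>x) = \<sim>\<^bsub>T'\<^esub>(g x)) \<and>
     (\<forall>x \<in> carrier T. \<forall>y \<in> carrier T. g (x \<leadsto>\<^bsub>T\<^esub> y) = (g x \<leadsto>\<^bsub>T'\<^esub> g y)) \<and>
     (\<forall>x \<in> carrier T. \<forall>y \<in> carrier T. \<c>\<^bsub>T\<^esub> \<sqsubseteq>\<^bsub>T\<^esub> x \<longrightarrow> \<c>\<^bsub>T\<^esub> \<sqsubseteq>\<^bsub>T\<^esub> y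
        \<longrightarrow> g (x \<sqinter>\<^bsub>T\<^esub> y) = g x \<sqinter>\<^bsub>T'\<^esub> g y)"

definition KhIS0 :: "('u khis, ('u khis, 'u) arrow) cat_data" where
  "KhIS0 = concrete_cat {T. khis0 T} carrier khis_hom"

definition K6_K7 :: "'u khis \<Rightarrow> bool" where
  "K6_K7 T \<longleftrightarrow>
     (\<forall>x \<in> carrier T. \<forall>y \<in> carrier T.
        x \<sqsubseteq>\<^bsub>T\<^esub> ((y \<squnion>\<^bsub>T\<^esub> \<c>\<^bsub>T\<^esub>) \<leadsto>\<^bsub>T\<^esub> ((x \<squnion>\<^bsub>T\<^esub> \<c>\<^bsub>T\<^esub>) \<sqinter>\<^bsub>T\<^esub> (y \<squnion>\<^bsub>T\<^esub> \<c>\<^bsub>T\<^esub>)))) \<and>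
     (\<forall>x \<in> carrier T. \<forall>y \<in> carrier T. \<forall>z \<in> carrier T.
        (x \<leadsto>\<^bsub>T\<^esub> ((y \<squnion>\<^bsub>T\<^esub> \<c>\<^bsub>T\<^esub>) \<sqinter>\<^bsub>T\<^esub> (z \<squnion>\<^bsub>T\<^esub> \<c>\<^bsub>T\<^esub>)))
          = (x \<leadsto>\<^bsub>T\<^esub> (y \<squnion>\<^bsub>T\<^esub> \<c>\<^bsub>T\<^esub>)) \<sqinter>\<^bsub>T\<^esub> (x \<leadsto>\<^bsub>T\<^esub> (z \<squnion>\<^bsub>T\<^esub> \<c>\<^bsub>T\<^esub>)))"

definition KIS0 :: "('u khis, ('u khis, 'u) arrow) cat_data" where
  "KIS0 = full_subcat KhIS0 K6_K7"


section \<open>The functors and the natural transformations\<close>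

datatype 'a univ = Atom 'a | UPair (ufst: "'a univ") (usnd: "'a univ")

text \<open>
  A HOL category has its objects on one carrier type, whereas \<open>K(H)\<close> consists of pairs of
  elements of \<open>H\<close>. To have \<open>C \<circ> K\<close> and \<open>K \<circ> C\<close> as endofunctors, all carriers are
  taken inside the above type, closed under ordered pairs, \<^const>\<open>UPair\<close> serving as the pair constructor.
  The type of atoms is arbitrary and \<^const>\<open>Atom\<close> is injective, so a structure on any HOL type
  has an isomorphic copy here.
\<close>

definition K_obj :: "'a univ isl \<Rightarrow> 'a univ khis" where
  "K_obj H =
     \<lparr>carrier = {UPair a b | a b. a \<in> carrier H \<and> b \<in> carrier H \<and> imeet H a b = izero H},
      eq = (=),
      le = (\<lambda>z w. isl_le H (ufst z) (ufst w) \<and> isl_le H (usnd w) (usnd z)),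
      neg = (\<lambda>z. UPair (usnd z) (ufst z)),
      centre = UPair (izero H) (izero H),
      kimp = (\<lambda>z w. UPair (imeet H (iimp H (ufst z) (ufst w)) (iimp H (usnd w) (usnd z)))
                         (imeet H (ufst z) (usnd w))),
      kzero = UPair (izero H) (ione H),
      kone = UPair (ione H) (izero H)\<rparr>"

definition K_arr :: "('a univ isl, 'a univ) arrow \<Rightarrow> ('a univ khis, 'a univ) arrow" where
  "K_arr f =
     \<lparr>src = K_obj (src f),
      tgt = K_obj (tgt f),
      fn = (\<lambda>z \<in> carrier (K_obj (src f)). UPair (fn f (ufst z)) (fn f (usnd z)))\<rparr>"

definition K_functor ::
    "('a univ isl, ('a univ isl, 'a univ) arrow, 'a univ khis, ('a univ khis, 'a univ) arrow)
      functor_data" where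
  "K_functor = \<lparr>OMap = K_obj, AMap = K_arr\<rparr>"

definition C_obj :: "'u khis \<Rightarrow> 'u isl" where
  "C_obj T =
     \<lparr>carrier = {x \<in> carrier T. \<c>\<^bsub>T\<^esub> \<sqsubseteq>\<^bsub>T\<^esub> x},
      imeet = (\<lambda>x y. x \<sqinter>\<^bsub>T\<^esub> y),
      iimp = (\<lambda>x y. x \<leadsto>\<^bsub>T\<^esub> y),
      izero = \<c>\<^bsub>T\<^esub>,
      ione = kone T\<rparr>"

definition C_arr :: "('u khis, 'u) arrow \<Rightarrow> ('u isl, 'u) arrow" where
  "C_arr g =
     \<lparr>src = C_obj (src g),
      tgt = C_obj (tgt g),
      fn = restrict (fn g) (carrier (C_obj (src g)))\<rparr>"

definition C_functor ::
    "('u khis, ('u khis, 'u) arrow, 'u isl, ('u isl, 'u) arrow) functor_data" where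
  "C_functor = \<lparr>OMap = C_obj, AMap = C_arr\<rparr>"

definition \<alpha> :: "'a univ isl \<Rightarrow> ('a univ isl, 'a univ) arrow" where
  "\<alpha> H = \<lparr>src = H, tgt = C_obj (K_obj H), fn = (\<lambda>a \<in> carrier H. UPair a (izero H))\<rparr>"

definition \<beta> :: "'a univ khis \<Rightarrow> ('a univ khis, 'a univ) arrow" where
  "\<beta> T = \<lparr>src = T, tgt = K_obj (C_obj T),
          fn = (\<lambda>x \<in> carrier T. UPair (x \<squnion>\<^bsub>T\<^esub> \<c>\<^bsub>T\<^esub>) (\<sim>\<^bsub>T\<^esub>x \<squnion>\<^bsub>T\<^esub> \<c>\<^bsub>T\<^esub>))\<rparr>"

end

(*
  The implication makes beta surjective: for p, q above c with infimum c, the element x with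
  x v c = p and ~x v c = q is the infimum of p and q -> ~q. It also makes beta natural,
  because x v c = (c -> x) -> x is definable: in K(H), c -> (a, b) is (b -> 0, 0), and a is
  the meet of (b -> 0) -> a and b -> 0 when a and b have meet 0. Residuation in C(T) comes
  from K2 in one direction, and from K6 and the monotonicity contained in K7 in the other.
*)
theory Submission
  imports Defs
begin

section \<open>Concrete categories\<close>

text \<open>Under \<beta> an element x is read as the pair with coordinates x v c and ~x v c, and
  the axioms become statements on coordinates. The infimum axiom for c says that the pair is
  disjoint. The order axiom, once the meet of x and c is rewritten as ~(~x v c), says that the order
  is the coordinatewise one of \<open>K_obj\<close>. K5 and the negation of K4 compute the two
  coordinates of x -> y. So injectivity, reflection of the order and compatibility with -> are close
  to the axioms, and the construction of preimages is the real work. The obstacle to naturality is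
  that morphisms are only required to respect the order, ~, -> and meets above c. The centre is
  recovered as the only fixed point of ~, and 1 as x -> x. The term for x v c is verified by
  computing with pairs in \<open>K_obj H\<close> and then pulled back to an arbitrary object along
  \<beta>. This is not circular: the transfer uses, for one object at a time, only that \<beta> is
  injective and respects ->, c and joins with c.\<close>

lemma cat_functor_id: "category A \<Longrightarrow> cat_functor A A id_functor"
  by (simp add: cat_functor_def cat_functor_axioms_def id_functor_def)

lemma cat_functor_comp:
  assumes "cat_functor A B F" "cat_functor B D G"
  shows "cat_functor A D (comp_functor G F)"
proof -
  interpret F: cat_functor A B F by fact
  interpret G: cat_functor B D G by fact
  show ?thesis
    by unfold_locales (simp_all add: comp_functor_def F.map_obj F.map_arr F.map_dom F.map_cod
        F.map_ident F.map_comp G.map_obj G.map_arr G.map_dom G.map_cod G.map_ident G.map_comp)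
qed

lemma category_concrete_cat:
  assumes "\<And>X. X \<in> Ob \<Longrightarrow> hm X X (\<lambda>x\<in>U X. x)"
    and "\<And>X Y Z f g. \<lbrakk>X \<in> Ob; Y \<in> Ob; Z \<in> Ob; f \<in> U X \<rightarrow>\<^sub>E U Y; g \<in> U Y \<rightarrow>\<^sub>E U Z; hm X Y f; hm Y Z g\<rbrakk>
        \<Longrightarrow> hm X Z (compose (U X) g f)"
  shows "category (concrete_cat Ob U hm)"
proof -
  have compE: "compose A g f \<in> A \<rightarrow>\<^sub>E D" if "f \<in> A \<rightarrow>\<^sub>E B" "g \<in> B \<rightarrow>\<^sub>E D" for A B D and f g :: "'b \<Rightarrow> 'b"
    using that by (auto simp: compose_def)
  show ?thesis
  proof (unfold_locales, goal_cases)
    \<comment> \<open>Case numbers follow the axioms of \<open>category\<close>: 6 is closure under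
      composition, 9 and 10 are the unit laws, 11 is associativity. The unit laws hold on the nose
      because arrows are extensional functions.\<close>
    case (6 f g)
    then show ?case
      using compE[of "fn f" "U (src f)" "U (tgt f)" "fn g" "U (tgt g)"]
        assms(2)[of "src f" "tgt f" "tgt g" "fn f" "fn g"]
      by (simp add: concrete_cat_def)
  next
    case (9 f)
    then show ?case
      by (intro arrow.equality)
        (auto simp: concrete_cat_def compose_def fun_eq_iff PiE_def extensional_def)
  next
    case (10 f)
    then show ?case
      by (intro arrow.equality)
        (auto simp: concrete_cat_def compose_def fun_eq_iff PiE_def extensional_def)
  next
    case (11 f g h)
    then show ?case by (auto simp: concrete_cat_def compose_def fun_eq_iff)
  qed (simp_all add: concrete_cat_def assms(1))
qed

text \<open>Makes \<open>KIS0\<close> a concrete category again, so that the general lemmas on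
  \<open>concrete_cat\<close> apply to it.\<close>

lemma full_subcat_concrete_cat:
  "full_subcat (concrete_cat Ob U hm) P = concrete_cat {X \<in> Ob. P X} U hm"
  by (auto simp: full_subcat_def concrete_cat_def)

text \<open>The predicate \<open>hm\<close> is arbitrary, so a bijection satisfying it may have an
  inverse that does not; hence the separate hypothesis on \<open>inv_into\<close>.\<close>

lemma iso_arrow_concrete_catI:
  assumes f: "f \<in> Arr (concrete_cat Ob U hm)"
    and bij: "bij_betw (fn f) (U (src f)) (U (tgt f))"
    and inv: "hm (tgt f) (src f) (\<lambda>y\<in>U (tgt f). inv_into (U (src f)) (fn f) y)"
  shows "iso_arrow (concrete_cat Ob U hm) f"
proof -
  let ?g = "\<lparr>src = tgt f, tgt = src f, fn = (\<lambda>y\<in>U (tgt f). inv_into (U (src f)) (fn f) y)\<rparr>"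
  have "?g \<in> Arr (concrete_cat Ob U hm)"
    using f bij inv by (auto simp: concrete_cat_def bij_betw_def inv_into_into)
  moreover have "compose (U (src f)) (fn ?g) (fn f) = (\<lambda>x\<in>U (src f). x)"
    using compose_inv_into_id[OF bij] by simp
  moreover have "compose (U (tgt f)) (fn f) (fn ?g) = (\<lambda>x\<in>U (tgt f). x)"
    using compose_id_inv_into[of "fn f" "U (src f)" "U (tgt f)"] bij by (simp add: bij_betw_def)
  ultimately show ?thesis
    unfolding iso_arrow_def using f by (intro conjI bexI[of _ ?g]) (simp_all add: concrete_cat_def)
qed


section \<open>Bounded implicative semilattices\<close>

context bounded_implicative_semilattice
begin

lemmas closed = meet_closed imp_closed zero_closed one_closed

lemma refl: "a \<in> carrier H \<Longrightarrow> isl_le H a a"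
  by (simp add: isl_le_def meet_idem)

lemma antisym: "\<lbrakk>isl_le H a b; isl_le H b a; a \<in> carrier H; b \<in> carrier H\<rbrakk> \<Longrightarrow> a = b"
  using meet_comm by (metis isl_le_def)

lemma trans:
  "\<lbrakk>isl_le H a b; isl_le H b d; a \<in> carrier H; b \<in> carrier H; d \<in> carrier H\<rbrakk> \<Longrightarrow> isl_le H a d"
  using meet_assoc by (metis isl_le_def)

lemma meet_le1: "\<lbrakk>a \<in> carrier H; b \<in> carrier H\<rbrakk> \<Longrightarrow> isl_le H (imeet H a b) a"
  by (metis isl_le_def meet_assoc meet_comm meet_idem)

lemma meet_le2: "\<lbrakk>a \<in> carrier H; b \<in> carrier H\<rbrakk> \<Longrightarrow> isl_le H (imeet H a b) b"
  by (simp add: isl_le_def meet_assoc meet_idem)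

lemma meet_greatest:
  "\<lbrakk>isl_le H d a; isl_le H d b; a \<in> carrier H; b \<in> carrier H; d \<in> carrier H\<rbrakk>
    \<Longrightarrow> isl_le H d (imeet H a b)"
  by (metis isl_le_def meet_assoc)

lemma zero_meet: "a \<in> carrier H \<Longrightarrow> imeet H (izero H) a = izero H"
  using zero_least by (simp add: isl_le_def)

lemma meet_zero: "a \<in> carrier H \<Longrightarrow> imeet H a (izero H) = izero H"
  using zero_meet zero_closed by (simp add: meet_comm)

lemma meet_one: "a \<in> carrier H \<Longrightarrow> imeet H a (ione H) = a"
  using one_greatest by (simp add: isl_le_def)

lemma one_meet: "a \<in> carrier H \<Longrightarrow> imeet H (ione H) a = a"
  using meet_one one_closed by (simp add: meet_comm)

lemma one_le_iff: "a \<in> carrier H \<Longrightarrow> isl_le H (ione H) a \<longleftrightarrow> a = ione H"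
  using one_meet by (auto simp: isl_le_def)

lemma imp_eq_one_iff: "\<lbrakk>a \<in> carrier H; b \<in> carrier H\<rbrakk> \<Longrightarrow> iimp H a b = ione H \<longleftrightarrow> isl_le H a b"
  using residuation[of "ione H" a b] one_le_iff[of "iimp H a b"] by (simp add: closed one_meet)

lemma zero_imp: "a \<in> carrier H \<Longrightarrow> iimp H (izero H) a = ione H"
  by (simp add: imp_eq_one_iff closed zero_least)

lemma imp_self: "a \<in> carrier H \<Longrightarrow> iimp H a a = ione H"
  by (simp add: imp_eq_one_iff refl)

lemma imp_meet_le: "\<lbrakk>a \<in> carrier H; b \<in> carrier H\<rbrakk> \<Longrightarrow> isl_le H (imeet H (iimp H a b) a) b"
  by (simp add: residuation closed refl)

lemma le_zero_iff: "a \<in> carrier H \<Longrightarrow> isl_le H a (izero H) \<longleftrightarrow> a = izero H"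
  using meet_zero by (auto simp: isl_le_def)

text \<open>This is what K7 for \<open>K_obj H\<close> reduces to, as \<open>imp_meet_self\<close>
  is for K6.\<close>

lemma imp_meet_distrib:
  assumes "a \<in> carrier H" "b \<in> carrier H" "d \<in> carrier H"
  shows "iimp H a (imeet H b d) = imeet H (iimp H a b) (iimp H a d)" (is "?l = ?r")
proof (rule antisym)
  have "isl_le H (imeet H ?l a) (imeet H b d)" using assms by (simp add: imp_meet_le closed)
  then have "isl_le H (imeet H ?l a) b" "isl_le H (imeet H ?l a) d"
    using assms by (meson trans meet_le1 meet_le2 closed)+
  then show "isl_le H ?l ?r" using assms by (simp add: residuation meet_greatest closed)
  \<comment> \<open>The \<open>b\<close> bound here is fresh, while \<open>?r\<close> keeps the
    outer one; the fact serves for both \<open>b\<close> and \<open>d\<close>.\<close>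
  have "isl_le H (imeet H ?r a) b" if "isl_le H ?r (iimp H a b)" "b \<in> carrier H" for b
    using that assms by (simp add: residuation closed)
  then have "isl_le H (imeet H ?r a) (imeet H b d)"
    using assms by (intro meet_greatest) (simp_all add: closed meet_le1 meet_le2)
  then show "isl_le H ?r ?l" using assms by (simp add: residuation closed)
qed (use assms in \<open>simp_all add: closed\<close>)

lemma imp_meet_self:
  assumes "a \<in> carrier H" "b \<in> carrier H"
  shows "isl_le H a (iimp H b (imeet H a b))"
  using assms by (simp add: residuation[symmetric] closed refl)

end

lemma isl_hom_compose:
  assumes "bounded_implicative_semilattice H" "f \<in> carrier H \<rightarrow>\<^sub>E carrier H'"
    and "isl_hom H H' f" "isl_hom H' H'' g"
  shows "isl_hom H H'' (compose (carrier H) g f)"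
proof -
  interpret bounded_implicative_semilattice H by fact
  show ?thesis using assms(2-4) closed by (auto simp: isl_hom_def compose_def PiE_iff)
qed

text \<open>For algebras bijectivity is enough: by injectivity, each equation for the inverse
  follows from its image under \<open>f\<close>.\<close>

lemma isl_hom_inv:
  assumes "bounded_implicative_semilattice H" "isl_hom H H' f"
    and bij: "bij_betw f (carrier H) (carrier H')"
    and "bounded_implicative_semilattice H'"
  shows "isl_hom H' H (\<lambda>y\<in>carrier H'. inv_into (carrier H) f y)"
proof -
  interpret bounded_implicative_semilattice H by fact
  interpret H': bounded_implicative_semilattice H' by fact
  have inj: "inj_on f (carrier H)" and im: "f ` carrier H = carrier H'"
    using bij by (auto simp: bij_betw_def)
  have inv: "inv_into (carrier H) f y \<in> carrier H" "f (inv_into (carrier H) f y) = y"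
    if "y \<in> carrier H'" for y
    using that im by (auto simp: inv_into_into f_inv_into_f)
  show ?thesis
    unfolding isl_hom_def
    using assms(2) closed H'.closed inv
    by (auto simp: isl_hom_def intro!: inv_into_f_eq[OF inj])
qed

lemma category_IS0: "category IS0"
  unfolding IS0_def
proof (rule category_concrete_cat)
  fix H :: "'a isl"
  assume "H \<in> {H. bounded_implicative_semilattice H}"
  then interpret bounded_implicative_semilattice H by simp
  show "isl_hom H H (\<lambda>x\<in>carrier H. x)" by (simp add: isl_hom_def closed)
qed (use isl_hom_compose in auto)


section \<open>Kleene posets with implication\<close>

context partial_order
begin

text \<open>Uniqueness of least upper bounds identifies the Hilbert choice behind
  \<open>\<squnion>\<close> with any element known to be a supremum; the computations of joins below
  rest on this.\<close>

lemma join_eq: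
  assumes "least L s (Upper L {x, y})"
  shows "x \<squnion> y = s"
  unfolding join_def sup_def using assms by (blast intro: some_equality least_unique)

lemma meet_eq:
  assumes "greatest L s (Lower L {x, y})"
  shows "x \<sqinter> y = s"
  unfolding meet_def inf_def using assms by (blast intro: some_equality greatest_unique)

lemma is_lub_pair_iff:
  assumes "x \<in> carrier L" "y \<in> carrier L"
  shows "is_lub L s {x, y} \<longleftrightarrow> s \<in> carrier L \<and> x \<sqsubseteq> s \<and> y \<sqsubseteq> s \<and>
    (\<forall>u\<in>carrier L. x \<sqsubseteq> u \<longrightarrow> y \<sqsubseteq> u \<longrightarrow> s \<sqsubseteq> u)"
  using assms by (auto simp: least_def Upper_def)

lemma is_glb_pair_iff:
  assumes "x \<in> carrier L" "y \<in> carrier L"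
  shows "is_glb L s {x, y} \<longleftrightarrow> s \<in> carrier L \<and> s \<sqsubseteq> x \<and> s \<sqsubseteq> y \<and>
    (\<forall>u\<in>carrier L. u \<sqsubseteq> x \<longrightarrow> u \<sqsubseteq> y \<longrightarrow> u \<sqsubseteq> s)"
  using assms by (auto simp: greatest_def Lower_def)

end

section \<open>Joins with the centre and De Morgan rules\<close>

context kleene_poset
begin

declare neg_closed [simp] centre_closed [simp] neg_neg [simp]

lemma neg_centre [simp]: "\<sim>\<c> = \<c>"
  using centre_neg by simp

lemma neg_le_iff: "\<lbrakk>x \<in> carrier T; y \<in> carrier T\<rbrakk> \<Longrightarrow> \<sim>x \<sqsubseteq> \<sim>y \<longleftrightarrow> y \<sqsubseteq> x"
  by (metis neg_antitone neg_closed neg_neg)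

lemma neg_le_swap: "\<lbrakk>x \<in> carrier T; y \<in> carrier T\<rbrakk> \<Longrightarrow> \<sim>x \<sqsubseteq> y \<longleftrightarrow> \<sim>y \<sqsubseteq> x"
  by (metis neg_le_iff neg_closed neg_neg)

lemma le_neg_swap: "\<lbrakk>x \<in> carrier T; y \<in> carrier T\<rbrakk> \<Longrightarrow> x \<sqsubseteq> \<sim>y \<longleftrightarrow> y \<sqsubseteq> \<sim>x"
  by (metis neg_le_iff neg_closed neg_neg)

lemma centre_le_neg_iff: "x \<in> carrier T \<Longrightarrow> \<c> \<sqsubseteq> \<sim>x \<longleftrightarrow> x \<sqsubseteq> \<c>"
  using le_neg_swap[of \<c> x] by simp

lemma neg_le_centre_iff: "x \<in> carrier T \<Longrightarrow> \<sim>x \<sqsubseteq> \<c> \<longleftrightarrow> \<c> \<sqsubseteq> x"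
  using neg_le_swap[of x \<c>] by simp

lemma join_centre_lub: "x \<in> carrier T \<Longrightarrow> is_lub T (x \<squnion> \<c>) {x, \<c>}"
  using join_centre_exists join_eq by metis

lemma join_centre_closed [simp]: "x \<in> carrier T \<Longrightarrow> x \<squnion> \<c> \<in> carrier T"
  and le_join_centre: "x \<in> carrier T \<Longrightarrow> x \<sqsubseteq> x \<squnion> \<c>"
  and centre_le_join [simp]: "x \<in> carrier T \<Longrightarrow> \<c> \<sqsubseteq> x \<squnion> \<c>"
  and join_centre_least:
    "\<lbrakk>x \<sqsubseteq> u; \<c> \<sqsubseteq> u; x \<in> carrier T; u \<in> carrier T\<rbrakk> \<Longrightarrow> x \<squnion> \<c> \<sqsubseteq> u"
  using join_centre_lub[of x] by (simp_all add: is_lub_pair_iff)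

lemma join_centre_mono:
  "\<lbrakk>x \<sqsubseteq> y; x \<in> carrier T; y \<in> carrier T\<rbrakk> \<Longrightarrow> x \<squnion> \<c> \<sqsubseteq> y \<squnion> \<c>"
  by (meson centre_le_join join_centre_closed join_centre_least le_join_centre le_trans)

lemma join_centre_absorb: "\<lbrakk>\<c> \<sqsubseteq> x; x \<in> carrier T\<rbrakk> \<Longrightarrow> x \<squnion> \<c> = x"
  by (meson join_centre_closed join_centre_least le_antisym le_join_centre le_refl)

lemma join_centre_absorb': "\<lbrakk>x \<sqsubseteq> \<c>; x \<in> carrier T\<rbrakk> \<Longrightarrow> x \<squnion> \<c> = \<c>"
  by (meson centre_closed centre_le_join join_centre_closed join_centre_least le_antisym le_refl)

text \<open>An antitone involution reverses the order bijectively, so it carries an infimum that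
  exists to the supremum of the negations.\<close>

lemma join_neg:
  assumes "is_glb T i {x, y}" "x \<in> carrier T" "y \<in> carrier T"
  shows "\<sim>x \<squnion> \<sim>y = \<sim>i"
  using assms by (intro join_eq) (auto simp: is_lub_pair_iff is_glb_pair_iff neg_le_iff, metis neg_le_swap neg_closed)

lemma meet_neg:
  assumes "is_lub T i {x, y}" "x \<in> carrier T" "y \<in> carrier T"
  shows "\<sim>x \<sqinter> \<sim>y = \<sim>i"
  using assms by (intro meet_eq) (auto simp: is_lub_pair_iff is_glb_pair_iff neg_le_iff, metis le_neg_swap neg_closed)

lemma meet_centre: "x \<in> carrier T \<Longrightarrow> x \<sqinter> \<c> = \<sim>(\<sim>x \<squnion> \<c>)"
  using meet_neg[OF join_centre_lub, of "\<sim>x"] by simp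

lemma neg_meet_centre: "x \<in> carrier T \<Longrightarrow> \<sim>(x \<sqinter> \<c>) = \<sim>x \<squnion> \<c>"
  by (simp add: meet_centre)

text \<open>If \<open>\<sim>x = x\<close>, the two joins in \<open>centre_inf\<close> coincide, so
  their infimum, the centre, lies above \<open>x\<close>; negating gives the other inequality. This
  is how morphisms come to preserve the centre.\<close>

lemma neg_fixed_eq_centre:
  assumes "x \<in> carrier T" "\<sim>x = x"
  shows "x = \<c>"
proof -
  have glb: "is_glb T \<c> {x \<squnion> \<c>, \<sim>x \<squnion> \<c>}" by (rule centre_inf[OF assms(1)])
  have "x \<sqsubseteq> \<c>"
    \<comment> \<open>After rewriting, the pair has two equal entries; \<open>insert_absorb2\<close>
      would collapse it to a singleton, which \<open>is_glb_pair_iff\<close> does not match.\<close>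
    using glb assms le_join_centre[of x] by (auto simp: is_glb_pair_iff simp del: insert_absorb2)
  then show ?thesis
    using assms centre_le_neg_iff[of x] by (auto intro: le_antisym)
qed

text \<open>By \<open>meet_centre\<close>, comparing meets with the centre in
  \<open>order_determined\<close> amounts to comparing the joins of the negations. This is
  injectivity of \<beta>.\<close>

lemma eq_iff_joins:
  assumes "x \<in> carrier T" "y \<in> carrier T" "x \<squnion> \<c> = y \<squnion> \<c>" "\<sim>x \<squnion> \<c> = \<sim>y \<squnion> \<c>"
  shows "x = y"
  using order_determined[of x y] order_determined[of y x] assms
  by (intro le_antisym) (simp_all add: meet_centre)

lemma le_iff_joins:
  assumes "x \<in> carrier T" "y \<in> carrier T"
  shows "x \<sqsubseteq> y \<longleftrightarrow> x \<squnion> \<c> \<sqsubseteq> y \<squnion> \<c> \<and> \<sim>y \<squnion> \<c> \<sqsubseteq> \<sim>x \<squnion> \<c>"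
  using assms order_determined[of x y]
  by (auto simp: meet_centre neg_le_iff intro!: join_centre_mono)

end

context khis0
begin

declare kzero_closed [simp] kone_closed [simp] kimp_closed [simp]

lemma meet_commute: "x \<sqinter> y = y \<sqinter> x"
  by (simp add: meet_def insert_commute)

lemma meet_glb:
  assumes "\<c> \<sqsubseteq> x \<or> \<c> \<sqsubseteq> y" "x \<in> carrier T" "y \<in> carrier T"
  shows "is_glb T (x \<sqinter> y) {x, y}"
proof -
  obtain i where "is_glb T i {x, y}"
    using assms meet_exists[of x y] meet_exists[of y x] by (auto simp: insert_commute)
  then show ?thesis using meet_eq by simp
qed

lemma meet_closed': "\<lbrakk>\<c> \<sqsubseteq> x \<or> \<c> \<sqsubseteq> y; x \<in> carrier T; y \<in> carrier T\<rbrakk> \<Longrightarrow> x \<sqinter> y \<in> carrier T"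
  and meet_le1: "\<lbrakk>\<c> \<sqsubseteq> x \<or> \<c> \<sqsubseteq> y; x \<in> carrier T; y \<in> carrier T\<rbrakk> \<Longrightarrow> x \<sqinter> y \<sqsubseteq> x"
  and meet_le2: "\<lbrakk>\<c> \<sqsubseteq> x \<or> \<c> \<sqsubseteq> y; x \<in> carrier T; y \<in> carrier T\<rbrakk> \<Longrightarrow> x \<sqinter> y \<sqsubseteq> y"
  and meet_greatest: "\<lbrakk>\<c> \<sqsubseteq> x \<or> \<c> \<sqsubseteq> y; u \<sqsubseteq> x; u \<sqsubseteq> y; x \<in> carrier T; y \<in> carrier T; u \<in> carrier T\<rbrakk>
      \<Longrightarrow> u \<sqsubseteq> x \<sqinter> y"
  using meet_glb[of x y] by (simp_all add: is_glb_pair_iff)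

lemma meet_eq_left_iff:
  "\<lbrakk>\<c> \<sqsubseteq> x \<or> \<c> \<sqsubseteq> y; x \<in> carrier T; y \<in> carrier T\<rbrakk> \<Longrightarrow> x \<sqinter> y = x \<longleftrightarrow> x \<sqsubseteq> y"
  by (metis le_antisym le_refl meet_closed' meet_greatest meet_le1 meet_le2)

lemma imp_ge_centre: "\<lbrakk>\<c> \<sqsubseteq> y; x \<in> carrier T; y \<in> carrier T\<rbrakk> \<Longrightarrow> \<c> \<sqsubseteq> x \<leadsto> y"
  using K1[of x y] by (simp add: join_centre_absorb)

text \<open>The negation of K4, whose right-hand side is dual to the meet here. It gives the second
  coordinate of an implication under \<beta>; \<open>imp_join_centre\<close>, which is K5 at
  \<open>\<sim>y\<close>, gives the first.\<close>

lemma neg_imp_join_centre: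
  assumes "x \<in> carrier T" "y \<in> carrier T"
  shows "\<sim>(x \<leadsto> y) \<squnion> \<c> = (x \<squnion> \<c>) \<sqinter> (\<sim>y \<squnion> \<c>)"
proof -
  have "\<sim>(x \<squnion> \<c>) \<squnion> \<sim>(\<sim>y \<squnion> \<c>) = \<sim>((x \<squnion> \<c>) \<sqinter> (\<sim>y \<squnion> \<c>))"
    using assms by (intro join_neg meet_glb) simp_all
  then have "(x \<leadsto> y) \<sqinter> \<c> = \<sim>((x \<squnion> \<c>) \<sqinter> (\<sim>y \<squnion> \<c>))"
    using assms by (simp add: K4) (simp add: meet_centre)
  then show ?thesis
    using assms by (metis neg_meet_centre kimp_closed neg_neg meet_closed' join_centre_closed
        neg_closed centre_le_join)
qed

lemma imp_join_centre:
  assumes "x \<in> carrier T" "y \<in> carrier T"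
  shows "(x \<leadsto> y) \<squnion> \<c> = ((x \<squnion> \<c>) \<leadsto> (y \<squnion> \<c>)) \<sqinter> ((\<sim>y \<squnion> \<c>) \<leadsto> (\<sim>x \<squnion> \<c>))"
  using K5[of x "\<sim>y"] assms by simp

end

locale kis0 = khis0 T for T :: "'u khis" (structure) +
  assumes K6: "\<lbrakk>x \<in> carrier T; y \<in> carrier T\<rbrakk>
      \<Longrightarrow> x \<sqsubseteq> ((y \<squnion> \<c>) \<leadsto> ((x \<squnion> \<c>) \<sqinter> (y \<squnion> \<c>)))"
    and K7: "\<lbrakk>x \<in> carrier T; y \<in> carrier T; z \<in> carrier T\<rbrakk>
      \<Longrightarrow> (x \<leadsto> ((y \<squnion> \<c>) \<sqinter> (z \<squnion> \<c>))) = (x \<leadsto> (y \<squnion> \<c>)) \<sqinter> (x \<leadsto> (z \<squnion> \<c>))"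

lemma kis0_iff: "kis0 T \<longleftrightarrow> khis0 T \<and> K6_K7 T"
  by (auto simp: kis0_def kis0_axioms_def K6_K7_def)

lemma KIS0_eq: "KIS0 = concrete_cat {T. kis0 T} carrier khis_hom"
  by (simp add: KIS0_def KhIS0_def full_subcat_concrete_cat kis0_iff)

section \<open>Morphisms and the constants they preserve\<close>

locale khis0_hom = source: khis0 T + target: khis0 T' for T T' :: "'u khis" +
  fixes g :: "'u \<Rightarrow> 'u"
  assumes maps: "x \<in> carrier T \<Longrightarrow> g x \<in> carrier T'"
    and khis_hom: "khis_hom T T' g"
begin

lemma hom_mono: "\<lbrakk>x \<sqsubseteq>\<^bsub>T\<^esub> y; x \<in> carrier T; y \<in> carrier T\<rbrakk> \<Longrightarrow> g x \<sqsubseteq>\<^bsub>T'\<^esub> g y"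
  and hom_neg: "x \<in> carrier T \<Longrightarrow> g (\<sim>\<^bsub>T\<^esub>x) = \<sim>\<^bsub>T'\<^esub>(g x)"
  and hom_imp: "\<lbrakk>x \<in> carrier T; y \<in> carrier T\<rbrakk> \<Longrightarrow> g (x \<leadsto>\<^bsub>T\<^esub> y) = (g x \<leadsto>\<^bsub>T'\<^esub> g y)"
  and hom_meet: "\<lbrakk>\<c>\<^bsub>T\<^esub> \<sqsubseteq>\<^bsub>T\<^esub> x; \<c>\<^bsub>T\<^esub> \<sqsubseteq>\<^bsub>T\<^esub> y; x \<in> carrier T; y \<in> carrier T\<rbrakk>
      \<Longrightarrow> g (x \<sqinter>\<^bsub>T\<^esub> y) = g x \<sqinter>\<^bsub>T'\<^esub> g y"
  using khis_hom by (simp_all add: khis_hom_def)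

lemma hom_centre: "g \<c>\<^bsub>T\<^esub> = \<c>\<^bsub>T'\<^esub>"
  using hom_neg[of "\<c>\<^bsub>T\<^esub>"] by (intro target.neg_fixed_eq_centre) (simp_all add: maps)

lemma hom_ge_centre: "\<lbrakk>\<c>\<^bsub>T\<^esub> \<sqsubseteq>\<^bsub>T\<^esub> x; x \<in> carrier T\<rbrakk> \<Longrightarrow> \<c>\<^bsub>T'\<^esub> \<sqsubseteq>\<^bsub>T'\<^esub> g x"
  using hom_mono[of "\<c>\<^bsub>T\<^esub>" x] by (simp add: hom_centre)

lemma hom_one: "g (kone T) = kone T'"
  by (metis hom_imp maps source.K3 source.kone_closed target.K3)

lemma khis_hom_compose:
  assumes "khis_hom T' T'' h"
  shows "khis_hom T T'' (compose (carrier T) h g)"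
  using assms maps unfolding khis_hom_def
  by (simp add: compose_def hom_mono hom_neg hom_imp hom_meet hom_ge_centre source.meet_closed')

text \<open>Reflection of the order makes the inverse monotone. It also keeps preimages of elements
  above the centre above the centre, where \<open>g\<close> is known to preserve meets.\<close>

lemma khis_hom_inv:
  assumes bij: "bij_betw g (carrier T) (carrier T')"
    and emb: "\<And>x y. \<lbrakk>x \<in> carrier T; y \<in> carrier T; g x \<sqsubseteq>\<^bsub>T'\<^esub> g y\<rbrakk> \<Longrightarrow> x \<sqsubseteq>\<^bsub>T\<^esub> y"
  shows "khis_hom T' T (\<lambda>y\<in>carrier T'. inv_into (carrier T) g y)"
proof -
  let ?h = "inv_into (carrier T) g"
  have inj: "inj_on g (carrier T)" and im: "g ` carrier T = carrier T'"
    using bij by (auto simp: bij_betw_def)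
  have inv: "?h y \<in> carrier T" "g (?h y) = y" if "y \<in> carrier T'" for y
    using that im by (auto simp: inv_into_into f_inv_into_f)
  have ge: "\<c>\<^bsub>T\<^esub> \<sqsubseteq>\<^bsub>T\<^esub> ?h y" if "\<c>\<^bsub>T'\<^esub> \<sqsubseteq>\<^bsub>T'\<^esub> y" "y \<in> carrier T'" for y
    using that by (intro emb) (simp_all add: inv hom_centre)
  show ?thesis
    unfolding khis_hom_def
  proof (intro conjI ballI impI, goal_cases)
    case (1 x y)
    then show ?case by (simp add: emb inv)
  next
    case (2 x)
    then show ?case by (simp add: inv hom_neg inv_into_f_eq[OF inj])
  next
    case (3 x y)
    then show ?case by (simp add: inv hom_imp inv_into_f_eq[OF inj])
  next
    case (4 x y)
    then show ?case
      by (simp add: inv hom_meet ge source.meet_closed' target.meet_closed' inv_into_f_eq[OF inj])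
  qed
qed

end

lemma category_KIS0: "category KIS0"
  unfolding KIS0_eq
proof (rule category_concrete_cat)
  fix T :: "'a khis"
  assume "T \<in> {T. kis0 T}"
  then interpret kis0 T by simp
  show "khis_hom T T (\<lambda>x\<in>carrier T. x)" by (simp add: khis_hom_def meet_closed')
next
  fix X Y Z :: "'a khis" and f g
  assume *: "X \<in> {T. kis0 T}" "Y \<in> {T. kis0 T}" "f \<in> carrier X \<rightarrow>\<^sub>E carrier Y"
    "khis_hom X Y f" "khis_hom Y Z g"
  then interpret khis0_hom X Y f
    by (auto simp: khis0_hom_def khis0_hom_axioms_def kis0_iff)
  show "khis_hom X Z (compose (carrier X) g f)"
    using * by (simp add: khis_hom_compose)
qed


section \<open>The functor \<open>K\<close>\<close>

locale univ_isl = bounded_implicative_semilattice H for H :: "'a univ isl"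
begin

lemma K_carrier_iff [simp]: "UPair a b \<in> carrier (K_obj H) \<longleftrightarrow>
    a \<in> carrier H \<and> b \<in> carrier H \<and> imeet H a b = izero H"
  and K_le_iff [simp]: "UPair a b \<sqsubseteq>\<^bsub>K_obj H\<^esub> UPair d e \<longleftrightarrow> isl_le H a d \<and> isl_le H e b"
  and K_neg [simp]: "\<sim>\<^bsub>K_obj H\<^esub>(UPair a b) = UPair b a"
  and K_centre [simp]: "\<c>\<^bsub>K_obj H\<^esub> = UPair (izero H) (izero H)"
  and K_imp [simp]: "(UPair a b \<leadsto>\<^bsub>K_obj H\<^esub> UPair d e) =
    UPair (imeet H (iimp H a d) (iimp H e b)) (imeet H a e)"
  and K_zero [simp]: "kzero (K_obj H) = UPair (izero H) (ione H)"
  and K_one [simp]: "kone (K_obj H) = UPair (ione H) (izero H)"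
  by (simp_all add: K_obj_def)

lemma K_eq [simp]: "(.=\<^bsub>K_obj H\<^esub>) = (=)"
  by (simp add: K_obj_def)

lemma K_cases:
  assumes "z \<in> carrier (K_obj H)"
  obtains a b where "z = UPair a b" "a \<in> carrier H" "b \<in> carrier H" "imeet H a b = izero H"
  using assms by (auto simp: K_obj_def)

lemma K_ball: "(\<forall>z\<in>carrier (K_obj H). P z) \<longleftrightarrow>
    (\<forall>a\<in>carrier H. \<forall>b\<in>carrier H. imeet H a b = izero H \<longrightarrow> P (UPair a b))"
  by (auto simp: K_obj_def)

lemma K_partial_order: "partial_order (K_obj H)"
proof (unfold_locales, goal_cases)
  case (4 x)
  then show ?case by (auto elim!: K_cases simp: refl)
next
  case (5 x y)
  then show ?case by (auto elim!: K_cases simp: antisym)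
next
  case (6 x y z)
  then show ?case by (auto elim!: K_cases intro: trans)
qed auto

sublocale K: partial_order "K_obj H"
  by (rule K_partial_order)

text \<open>The second coordinate is ordered in reverse, so a join with the centre replaces it by
  its meet with zero.\<close>

lemma K_join_centre_lub:
  assumes "UPair a b \<in> carrier (K_obj H)"
  shows "is_lub (K_obj H) (UPair a (izero H)) {UPair a b, UPair (izero H) (izero H)}"
  using assms
  by (subst K.is_lub_pair_iff)
    (auto simp: closed K_ball refl zero_least meet_zero le_zero_iff)

text \<open>A meet of pairs asks for a join in the second coordinate, which \<open>H\<close> need
  not have. With one argument above the centre that join is with zero, hence trivial.\<close>

lemma K_meet_glb:
  assumes "a \<in> carrier H" "UPair d e \<in> carrier (K_obj H)"
  shows "is_glb (K_obj H) (UPair (imeet H a d) e) {UPair a (izero H), UPair d e}"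
proof -
  have "imeet H (imeet H a d) e = izero H"
    using assms by (simp add: meet_assoc meet_zero)
  then show ?thesis using assms
    by (subst K.is_glb_pair_iff)
      (auto simp: closed K_ball refl zero_least meet_zero meet_le1 meet_le2 meet_greatest)
qed

lemma K_join_centre:
  "UPair a b \<in> carrier (K_obj H) \<Longrightarrow>
    UPair a b \<squnion>\<^bsub>K_obj H\<^esub> UPair (izero H) (izero H) = UPair a (izero H)"
  by (rule K.join_eq[OF K_join_centre_lub])

lemma K_meet:
  "\<lbrakk>a \<in> carrier H; UPair d e \<in> carrier (K_obj H)\<rbrakk> \<Longrightarrow>
    UPair a (izero H) \<sqinter>\<^bsub>K_obj H\<^esub> UPair d e = UPair (imeet H a d) e"
  by (rule K.meet_eq[OF K_meet_glb])

lemma K_meet_centre: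
  "UPair a b \<in> carrier (K_obj H) \<Longrightarrow>
    UPair a b \<sqinter>\<^bsub>K_obj H\<^esub> UPair (izero H) (izero H) = UPair (izero H) b"
  using K_meet[of "izero H" a b]
  by (simp add: closed zero_meet meet_def insert_commute)

text \<open>The shape of the right-hand side of K4: below the centre only the reversed coordinate is
  left, so the join is a meet of \<open>H\<close>.\<close>

lemma K_join_below_centre:
  "\<lbrakk>a \<in> carrier H; b \<in> carrier H\<rbrakk> \<Longrightarrow>
    UPair (izero H) a \<squnion>\<^bsub>K_obj H\<^esub> UPair (izero H) b = UPair (izero H) (imeet H a b)"
  by (rule K.join_eq, subst K.is_lub_pair_iff)
    (auto simp: closed K_ball refl zero_least zero_meet meet_le1 meet_le2 meet_greatest)

text \<open>Modus ponens: whatever lies below \<open>a\<close>, \<open>e\<close> and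
  \<open>iimp H a d\<close> lies below \<open>d\<close> and \<open>e\<close>, which are
  disjoint.\<close>

lemma K_imp_closed:
  assumes "UPair a b \<in> carrier (K_obj H)" "UPair d e \<in> carrier (K_obj H)"
  shows "imeet H (imeet H (iimp H a d) (iimp H e b)) (imeet H a e) = izero H"
proof -
  have carr: "a \<in> carrier H" "b \<in> carrier H" "d \<in> carrier H" "e \<in> carrier H"
    and de: "imeet H d e = izero H"
    using assms by simp_all
  let ?p = "iimp H a d" and ?q = "iimp H e b"
  let ?t = "imeet H (imeet H ?p ?q) (imeet H a e)"
  note [simp] = carr closed
  have "isl_le H ?t (imeet H ?p ?q)" "isl_le H ?t (imeet H a e)"
    by (simp_all add: meet_le1 meet_le2)
  moreover have "isl_le H (imeet H ?p ?q) ?p" "isl_le H (imeet H a e) a" "isl_le H (imeet H a e) e"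
    by (simp_all add: meet_le1 meet_le2)
  ultimately have le: "isl_le H ?t ?p" "isl_le H ?t a" "isl_le H ?t e"
    by (meson trans closed carr)+
  then have "isl_le H ?t (imeet H ?p a)" by (simp add: meet_greatest)
  moreover have "isl_le H (imeet H ?p a) d" by (simp add: imp_meet_le)
  ultimately have "isl_le H ?t d" by (meson trans closed carr)
  then have "isl_le H ?t (imeet H d e)" using le by (simp add: meet_greatest)
  then show ?thesis by (simp add: de le_zero_iff)
qed

lemma khis0_K: "khis0 (K_obj H)"
\<comment> \<open>Goals 1 to 8 are the Kleene poset axioms, 9 to 12 the bounds, 13 and 14 the meets
  above the centre, 15 closure under implication, and 16 to 20 are K1 to K5.\<close>
proof (unfold_locales, goal_cases)
  case (1 x) then show ?case by (auto elim!: K_cases simp: meet_comm)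
next
  case 2 show ?case by (simp add: closed zero_meet)
next
  case (3 x) then show ?case by (auto elim!: K_cases)
next
  case (4 x y) then show ?case by (auto elim!: K_cases)
next
  case 5 show ?case by simp
next
  case (6 x) then show ?case
    using K_join_centre_lub by (metis K_centre K_cases)
next
  case (7 x) then show ?case
  proof (rule K_cases)
    fix a b assume *: "x = UPair a b" "a \<in> carrier H" "b \<in> carrier H" "imeet H a b = izero H"
    then have "imeet H b a = izero H" by (simp add: meet_comm)
    then show ?thesis
      using * K_meet_glb[of a b "izero H"] by (simp add: K_join_centre closed meet_zero)
  qed
next
  case (8 x y) then show ?case
    by (auto elim!: K_cases simp: K_join_centre K_meet_centre)
next
  case 9 show ?case by (simp add: closed zero_meet)
next
  case 10 show ?case by (simp add: closed meet_zero)
next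
  case (11 x) then show ?case by (auto elim!: K_cases simp: zero_least one_greatest)
next
  case (12 x) then show ?case by (auto elim!: K_cases simp: zero_least one_greatest)
next
  case (13 x y)
  \<comment> \<open>Being above the centre forces the second coordinate below zero, so it is
    zero.\<close>
  then obtain a where "x = UPair a (izero H)" "a \<in> carrier H"
    by (auto elim!: K_cases simp: le_zero_iff)
  with 13 show ?case using K_meet_glb by (metis K_cases)
next
  case (14 x y)
  then obtain a d e where *: "x = UPair a (izero H)" "y = UPair d e" "a \<in> carrier H"
    "d \<in> carrier H" "e \<in> carrier H" "imeet H d e = izero H"
    by (auto elim!: K_cases simp: le_zero_iff)
  then have "imeet H (imeet H a d) e = izero H" by (simp add: meet_assoc meet_zero)
  with * show ?case by (simp add: K_join_centre K_meet closed meet_zero)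
next
  case (15 x y) then show ?case
    using K_imp_closed by (auto elim!: K_cases simp: closed)
next
  case (16 x y) then show ?case
    by (auto elim!: K_cases simp: K_join_centre closed zero_least zero_imp meet_one meet_zero refl)
next
  case (17 x y) then show ?case
  proof (elim K_cases)
    fix a b d e assume *: "x = UPair a b" "a \<in> carrier H" "b \<in> carrier H" "imeet H a b = izero H"
      "y = UPair d e" "d \<in> carrier H" "e \<in> carrier H" "imeet H d e = izero H"
    \<comment> \<open>Above the centre the implication of pairs is that of \<open>H\<close>, so the
      antecedent of K2 is \<open>UPair (iimp H a d) (izero H)\<close>. The meet is commuted because
      \<open>K_meet\<close> expects the argument above the centre first.\<close>
    have "x \<sqinter>\<^bsub>K_obj H\<^esub> UPair (iimp H a d) (izero H) = UPair (imeet H (iimp H a d) a) b"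
      using * K_meet[of "iimp H a d" a b] by (simp add: meet_def insert_commute closed)
    then show ?thesis
      using * by (simp add: K_join_centre closed zero_imp meet_one meet_zero imp_meet_le zero_least)
  qed
next
  case (18 x) then show ?case
    by (auto elim!: K_cases simp: imp_self meet_one closed)
next
  case (19 x y) then show ?case
  proof (elim K_cases)
    fix a b d e assume *: "x = UPair a b" "a \<in> carrier H" "b \<in> carrier H" "imeet H a b = izero H"
      "y = UPair d e" "d \<in> carrier H" "e \<in> carrier H" "imeet H d e = izero H"
    then have "imeet H b a = izero H" by (simp add: meet_comm)
    then show ?thesis
      using * K_imp_closed[of a b d e] by (simp add: K_meet_centre K_join_below_centre closed)
  qed
next
  case (20 x y) then show ?case
  proof (elim K_cases)
    fix a b d e assume *: "x = UPair a b" "a \<in> carrier H" "b \<in> carrier H" "imeet H a b = izero H"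
      "y = UPair d e" "d \<in> carrier H" "e \<in> carrier H" "imeet H d e = izero H"
    then have "imeet H b a = izero H" "imeet H e d = izero H" by (simp_all add: meet_comm)
    then show ?thesis
      using * K_imp_closed[of a b e d]
      by (simp add: K_join_centre K_meet closed zero_imp meet_one meet_zero)
  qed
qed

lemma kis0_K: "kis0 (K_obj H)"
proof -
  interpret khis0 "K_obj H" by (rule khis0_K)
  show ?thesis
  proof (unfold_locales, goal_cases)
    case (1 x y) then show ?case
      by (auto elim!: K_cases simp: K_join_centre K_meet closed zero_imp meet_one meet_zero
          imp_meet_self zero_least)
  next
    case (2 x y z) then show ?case
      by (auto elim!: K_cases simp: K_join_centre K_meet closed zero_imp meet_one meet_zero
          imp_meet_distrib)
  qed
qed

end


text \<open>
  Suprema with the centre are definable from the implication, so morphisms preserve them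
  although this is not part of their definition.
\<close>

lemma (in univ_isl) K_join_centre_eq_imp:
  assumes "z \<in> carrier (K_obj H)"
  shows "z \<squnion>\<^bsub>K_obj H\<^esub> \<c>\<^bsub>K_obj H\<^esub> = (\<c>\<^bsub>K_obj H\<^esub> \<leadsto>\<^bsub>K_obj H\<^esub> z) \<leadsto>\<^bsub>K_obj H\<^esub> z"
proof -
  obtain a b where z: "z = UPair a b" and ab: "a \<in> carrier H" "b \<in> carrier H" "imeet H a b = izero H"
    using assms by (rule K_cases)
  let ?n = "iimp H b (izero H)"
  note [simp] = ab(1,2) closed
  \<comment> \<open>This meet is the second coordinate of the iterated implication; it has to
    vanish, as it does in the join with the centre.\<close>
  have nb: "imeet H ?n b = izero H"
    using imp_meet_le[of b "izero H"] by (simp add: le_zero_iff)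
  have "isl_le H a ?n"
    using residuation[of a b "izero H"] by (simp add: ab(3) refl)
  moreover have "isl_le H a (iimp H ?n a)"
    using residuation[of a ?n a] by (simp add: meet_le1)
  ultimately have "imeet H (iimp H ?n a) ?n = a"
    using imp_meet_le[of ?n a] by (intro antisym) (simp_all add: meet_greatest)
  then show ?thesis
    using ab(3) nb by (simp add: z K_join_centre zero_imp one_meet zero_meet)
qed


section \<open>The functor \<open>C\<close>\<close>

context kis0
begin

lemma C_simps [simp]:
  "carrier (C_obj T) = {x \<in> carrier T. \<c> \<sqsubseteq> x}" "imeet (C_obj T) = (\<sqinter>)"
  "iimp (C_obj T) = (\<leadsto>)" "izero (C_obj T) = \<c>" "ione (C_obj T) = kone T"
  by (auto simp: C_obj_def)

lemma C_le_iff: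
  "\<lbrakk>\<c> \<sqsubseteq> x \<or> \<c> \<sqsubseteq> y; x \<in> carrier T; y \<in> carrier T\<rbrakk> \<Longrightarrow> isl_le (C_obj T) x y \<longleftrightarrow> x \<sqsubseteq> y"
  by (simp add: isl_le_def meet_eq_left_iff)

lemma centre_le_meet:
  "\<lbrakk>\<c> \<sqsubseteq> x; \<c> \<sqsubseteq> y; x \<in> carrier T; y \<in> carrier T\<rbrakk> \<Longrightarrow> \<c> \<sqsubseteq> x \<sqinter> y"
  by (simp add: meet_greatest)

lemma imp_residuation:
  assumes "\<c> \<sqsubseteq> a" "\<c> \<sqsubseteq> b" "\<c> \<sqsubseteq> d" "a \<in> carrier T" "b \<in> carrier T" "d \<in> carrier T"
  shows "a \<sqinter> b \<sqsubseteq> d \<longleftrightarrow> a \<sqsubseteq> b \<leadsto> d"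
proof
  \<comment> \<open>All arguments are above the centre, so the joins with it disappear from K2, K6
    and K7.\<close>
  note [simp] = join_centre_absorb meet_closed' centre_le_meet imp_ge_centre
  assume "a \<sqinter> b \<sqsubseteq> d"
  then have "(a \<sqinter> b) \<sqinter> d = a \<sqinter> b" using assms by (simp add: meet_eq_left_iff)
  then have "(b \<leadsto> (a \<sqinter> b)) \<sqinter> (b \<leadsto> d) = b \<leadsto> (a \<sqinter> b)"
    using K7[of b "a \<sqinter> b" d] assms by simp
  then have "b \<leadsto> (a \<sqinter> b) \<sqsubseteq> b \<leadsto> d" using assms by (simp add: meet_eq_left_iff)
  moreover have "a \<sqsubseteq> b \<leadsto> (a \<sqinter> b)" using K6[of a b] assms by simp
  ultimately show "a \<sqsubseteq> b \<leadsto> d" using assms by (meson le_trans kimp_closed meet_closed')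
next
  note [simp] = join_centre_absorb meet_closed' centre_le_meet imp_ge_centre
  assume le: "a \<sqsubseteq> b \<leadsto> d"
  have "a \<sqinter> b \<sqsubseteq> b \<sqinter> (b \<leadsto> d)"
    using assms le by (meson meet_greatest meet_le1 meet_le2 le_trans kimp_closed meet_closed')
  also have "b \<sqinter> (b \<leadsto> d) \<sqsubseteq> d" using K2[of b d] assms by simp
  finally show "a \<sqinter> b \<sqsubseteq> d" using assms by simp
qed

lemma isl_C: "bounded_implicative_semilattice (C_obj T)"
proof (unfold_locales, goal_cases)
  case (5 a b d)
  then show ?case
    apply simp
    apply (intro le_antisym meet_greatest)
    apply (auto simp: meet_closed' centre_le_meet)
    apply (meson meet_le1 meet_le2 le_trans meet_closed' centre_le_meet)+
    done
next
  case (6 a b) then show ?case by (simp add: meet_commute)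
next
  case (7 a) then show ?case by (simp add: meet_eq_left_iff)
next
  case (10 a b d)
  then show ?case
    by (simp add: C_le_iff meet_closed' centre_le_meet imp_ge_centre imp_residuation)
qed (auto simp: meet_closed' centre_le_meet imp_ge_centre kone_greatest C_le_iff)

end


text \<open>\<open>khis_hom\<close> mentions neither bound of \<open>C_obj T\<close>;
  \<open>hom_centre\<close> and \<open>hom_one\<close> supply them, and \<open>hom_ge_centre\<close>
  keeps the values above the centre.\<close>

lemma isl_hom_C_arr:
  assumes "khis0_hom T T' g"
  shows "isl_hom (C_obj T) (C_obj T') (restrict g (carrier (C_obj T)))"
    and "restrict g (carrier (C_obj T)) \<in> carrier (C_obj T) \<rightarrow>\<^sub>E carrier (C_obj T')"
proof -
  interpret khis0_hom T T' g by fact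
  show "isl_hom (C_obj T) (C_obj T') (restrict g (carrier (C_obj T)))"
    "restrict g (carrier (C_obj T)) \<in> carrier (C_obj T) \<rightarrow>\<^sub>E carrier (C_obj T')"
    by (auto simp: isl_hom_def C_obj_def source.meet_closed' source.meet_greatest
        source.imp_ge_centre hom_meet hom_imp hom_centre hom_one source.kone_greatest maps
        hom_ge_centre)
qed

lemma Arr_IS0_iff: "f \<in> Arr IS0 \<longleftrightarrow>
    bounded_implicative_semilattice (src f) \<and> bounded_implicative_semilattice (tgt f) \<and>
    fn f \<in> carrier (src f) \<rightarrow>\<^sub>E carrier (tgt f) \<and> isl_hom (src f) (tgt f) (fn f)"
  by (simp add: IS0_def concrete_cat_def)

lemma Arr_KIS0_iff: "g \<in> Arr KIS0 \<longleftrightarrow>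
    kis0 (src g) \<and> kis0 (tgt g) \<and>
    fn g \<in> carrier (src g) \<rightarrow>\<^sub>E carrier (tgt g) \<and> khis_hom (src g) (tgt g) (fn g)"
  by (simp add: KIS0_eq concrete_cat_def)

lemma IS0_simps [simp]:
  "Obj IS0 = {H. bounded_implicative_semilattice H}" "Dom IS0 = src" "Cod IS0 = tgt"
  "Ident IS0 H = \<lparr>src = H, tgt = H, fn = (\<lambda>x\<in>carrier H. x)\<rparr>"
  "Comp IS0 f' f = \<lparr>src = src f, tgt = tgt f', fn = compose (carrier (src f)) (fn f') (fn f)\<rparr>"
  by (simp_all add: IS0_def concrete_cat_def)

lemma KIS0_simps [simp]:
  "Obj KIS0 = {T. kis0 T}" "Dom KIS0 = src" "Cod KIS0 = tgt"
  "Ident KIS0 T = \<lparr>src = T, tgt = T, fn = (\<lambda>x\<in>carrier T. x)\<rparr>"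
  "Comp KIS0 g' g = \<lparr>src = src g, tgt = tgt g', fn = compose (carrier (src g)) (fn g') (fn g)\<rparr>"
  by (simp_all add: KIS0_eq concrete_cat_def)

lemma khis0_hom_if_Arr: "g \<in> Arr KIS0 \<Longrightarrow> khis0_hom (src g) (tgt g) (fn g)"
  by (auto simp: Arr_KIS0_iff kis0_iff khis0_hom_def khis0_hom_axioms_def)

lemma functor_C: "cat_functor KIS0 IS0 C_functor"
proof -
  interpret source: category KIS0 by (rule category_KIS0)
  interpret target: category IS0 by (rule category_IS0)
  show ?thesis
  proof (unfold_locales, goal_cases)
    case (1 T) then show ?case by (simp add: C_functor_def kis0.isl_C)
  next
    case (2 g) then show ?case
      using isl_hom_C_arr[OF khis0_hom_if_Arr[OF 2]]
      by (simp add: Arr_IS0_iff Arr_KIS0_iff kis0.isl_C C_functor_def C_arr_def del: kis0.C_simps)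
  next
    case (3 g) then show ?case by (simp add: C_functor_def C_arr_def)
  next
    case (4 g) then show ?case by (simp add: C_functor_def C_arr_def)
  next
    case (5 T) then show ?case
      by (auto simp: C_functor_def C_arr_def C_obj_def fun_eq_iff)
  next
    case (6 f g)
    interpret khis0_hom "src f" "src g" "fn f" using 6 khis0_hom_if_Arr[of f] by simp
    show ?case using 6
      by (auto simp: C_functor_def C_arr_def C_obj_def fun_eq_iff compose_def maps hom_ge_centre)
  qed
qed

text \<open>Disjointness, order and implication of pairs are expressed by meet, implication and zero
  of \<open>H\<close>, the order through the equation in \<open>isl_le\<close>, so applying
  \<open>f\<close> to both coordinates respects them.\<close>

lemma khis_hom_K_arr:
  assumes "univ_isl H" "univ_isl H'" "isl_hom H H' f" "f \<in> carrier H \<rightarrow> carrier H'"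
  defines "h \<equiv> \<lambda>z\<in>carrier (K_obj H). UPair (f (ufst z)) (f (usnd z))"
  shows "khis_hom (K_obj H) (K_obj H') h"
    and "h \<in> carrier (K_obj H) \<rightarrow>\<^sub>E carrier (K_obj H')"
proof -
  interpret univ_isl H by fact
  interpret H': univ_isl H' by fact
  have hom: "f (imeet H a b) = imeet H' (f a) (f b)" "f (iimp H a b) = iimp H' (f a) (f b)"
    "f a \<in> carrier H'"
    if "a \<in> carrier H" "b \<in> carrier H" for a b
    using assms that by (auto simp: isl_hom_def)
  have zero: "f (izero H) = izero H'" using assms by (simp add: isl_hom_def)
  have disj: "imeet H' (f a) (f b) = izero H'"
    if "a \<in> carrier H" "b \<in> carrier H" "imeet H a b = izero H" for a b
    using that hom zero by metis
  have le: "isl_le H' (f a) (f b)" if "isl_le H a b" "a \<in> carrier H" "b \<in> carrier H" for a b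
    using that hom by (metis isl_le_def)
  have h: "h (UPair a b) = UPair (f a) (f b)" if "UPair a b \<in> carrier (K_obj H)" for a b
    using that by (simp add: h_def)
  show "h \<in> carrier (K_obj H) \<rightarrow>\<^sub>E carrier (K_obj H')"
    unfolding h_def by (auto elim!: K_cases simp: hom disj)
  show "khis_hom (K_obj H) (K_obj H') h"
    unfolding khis_hom_def
  proof (intro conjI ballI impI, goal_cases)
    case (1 x y) then show ?case by (auto elim!: K_cases simp: h le)
  next
    case (2 x) then show ?case by (auto elim!: K_cases simp: h meet_comm)
  next
    case (3 x y) then show ?case
      using K_imp_closed by (auto elim!: K_cases simp: h hom closed)
  next
    case (4 x y)
    then obtain a b where *: "x = UPair a (izero H)" "y = UPair b (izero H)"
      "a \<in> carrier H" "b \<in> carrier H"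
      by (auto elim!: K_cases simp: le_zero_iff)
    then show ?case
      by (simp add: h hom K_meet H'.K_meet closed H'.closed meet_zero H'.meet_zero zero)
  qed
qed

lemma univ_isl_iff [simp]: "univ_isl H \<longleftrightarrow> bounded_implicative_semilattice H"
  by (simp add: univ_isl_def)

lemma functor_K: "cat_functor IS0 KIS0 K_functor"
proof -
  interpret source: category IS0 by (rule category_IS0)
  interpret target: category KIS0 by (rule category_KIS0)
  show ?thesis
  proof (unfold_locales, goal_cases)
    case (1 H) then show ?case by (simp add: K_functor_def univ_isl.kis0_K)
  next
    case (2 f) then show ?case
      using khis_hom_K_arr[of "src f" "tgt f" "fn f"]
      by (auto simp: Arr_IS0_iff Arr_KIS0_iff univ_isl.kis0_K K_functor_def K_arr_def PiE_iff)
  next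
    case (3 g) then show ?case by (simp add: K_functor_def K_arr_def)
  next
    case (4 g) then show ?case by (simp add: K_functor_def K_arr_def)
  next
    case (5 H) then show ?case
      by (auto simp: K_functor_def K_arr_def K_obj_def fun_eq_iff)
  next
    case (6 f g)
    then have "univ_isl (src f)" "univ_isl (tgt f)"
        "isl_hom (src f) (tgt f) (fn f)" "fn f \<in> carrier (src f) \<rightarrow> carrier (tgt f)"
      by (auto simp: Arr_IS0_iff)
    from khis_hom_K_arr(2)[OF this] 6 show ?case
      apply (auto simp: K_functor_def K_arr_def fun_eq_iff compose_def PiE_iff)
      by (auto simp: K_obj_def)
  qed
qed


section \<open>The natural isomorphisms\<close>

context univ_isl
begin

text \<open>Surjective because a pair above the centre has second coordinate zero.\<close>

lemma alpha_bij: "bij_betw (\<lambda>a\<in>carrier H. UPair a (izero H)) (carrier H) (carrier (C_obj (K_obj H)))"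
proof -
  interpret T: kis0 "K_obj H" by (rule kis0_K)
  show ?thesis
    by (auto simp: bij_betw_def inj_on_def image_def closed meet_zero zero_least refl le_zero_iff
        elim!: K_cases)
qed

lemma alpha_hom: "isl_hom H (C_obj (K_obj H)) (\<lambda>a\<in>carrier H. UPair a (izero H))"
proof -
  interpret T: kis0 "K_obj H" by (rule kis0_K)
  show ?thesis
    by (simp add: isl_hom_def closed K_meet meet_zero zero_imp meet_one)
qed

lemma alpha_iso: "iso_arrow IS0 (\<alpha> H)"
proof -
  interpret T: kis0 "K_obj H" by (rule kis0_K)
  have "\<alpha> H \<in> Arr IS0"
    using alpha_bij alpha_hom bounded_implicative_semilattice_axioms T.isl_C
    by (auto simp: Arr_IS0_iff \<alpha>_def bij_betw_def simp del: T.C_simps)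
  then show ?thesis
    unfolding IS0_def
    using alpha_bij isl_hom_inv[OF _ alpha_hom alpha_bij T.isl_C]
      bounded_implicative_semilattice_axioms
    by (intro iso_arrow_concrete_catI) (simp_all add: \<alpha>_def del: T.C_simps)
qed

end

section \<open>The unit \<beta>: bijectivity, compatibility with implication, definable
  joins\<close>

locale univ_kis0 = kis0 T for T :: "'a univ khis" (structure)
begin

sublocale C: univ_isl "C_obj T"
  using isl_C by simp

text \<open>Disjointness in \<open>C_obj T\<close>, whose zero is the centre: this is why \<beta>
  takes values in \<open>K_obj (C_obj T)\<close>.\<close>

lemma joins_meet: "x \<in> carrier T \<Longrightarrow> (x \<squnion> \<c>) \<sqinter> (\<sim>x \<squnion> \<c>) = \<c>"
  by (rule meet_eq[OF centre_inf])

lemma exists_joins: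
  assumes "p \<in> carrier T" "q \<in> carrier T" "\<c> \<sqsubseteq> p" "\<c> \<sqsubseteq> q" "p \<sqinter> q = \<c>"
  shows "\<exists>x\<in>carrier T. x \<squnion> \<c> = p \<and> \<sim>x \<squnion> \<c> = q"
proof
  \<comment> \<open>In pairs, \<open>q\<close> is (q, 0) and \<open>\<sim>q\<close> is (0, q), so
    \<open>?y\<close> is (q -> 0, q). Its meet with (p, 0) has second coordinate q, and first
    coordinate p because p lies below q -> 0.\<close>
  let ?y = "q \<leadsto> \<sim>q" and ?x = "p \<sqinter> (q \<leadsto> \<sim>q)"
  note [simp] = assms(1-4)
  show x: "?x \<in> carrier T" by (simp add: meet_closed')
  have neg_q: "\<sim>q \<squnion> \<c> = \<c>" by (simp add: join_centre_absorb' neg_le_centre_iff)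
  have "?y \<squnion> \<c> = (q \<leadsto> \<c>) \<sqinter> (q \<leadsto> \<c>)"
    by (simp add: imp_join_centre neg_q join_centre_absorb)
  then have y: "?y \<squnion> \<c> = q \<leadsto> \<c>"
    by (simp add: meet_eq_left_iff imp_ge_centre)
  have "p \<sqsubseteq> q \<leadsto> \<c>"
    using imp_residuation[of p q \<c>] assms(5) by simp
  then have "?x \<squnion> \<c> = p" by (simp add: meet_join_centre y meet_eq_left_iff)
  moreover have "\<sim>?x \<squnion> \<c> = q"
  proof (rule le_antisym)
    \<comment> \<open>For the upper bound, \<open>\<sim>?x \<sqsubseteq> q\<close> is turned into
      \<open>\<sim>q \<sqsubseteq> ?x\<close> and checked on the two factors of the meet; the lower
      bound comes from \<open>?x \<sqsubseteq> ?y\<close>.\<close>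
    have y': "\<sim>?y \<squnion> \<c> = q"
      by (simp add: neg_imp_join_centre join_centre_absorb meet_eq_left_iff)
    then have "\<sim>?y \<sqsubseteq> q" using le_join_centre[of "\<sim>?y"] by simp
    then have "\<sim>q \<sqsubseteq> ?y" by (simp add: neg_le_swap[of q])
    moreover have "\<sim>q \<sqsubseteq> p"
      using le_trans[of "\<sim>q" \<c> p] by (simp add: neg_le_centre_iff)
    ultimately have "\<sim>q \<sqsubseteq> ?x" by (simp add: meet_greatest)
    then have "\<sim>?x \<sqsubseteq> q" using x by (simp add: neg_le_swap[of ?x])
    then show "\<sim>?x \<squnion> \<c> \<sqsubseteq> q" using x by (simp add: join_centre_least)
    have "\<sim>?y \<sqsubseteq> \<sim>?x" using x by (simp add: neg_le_iff meet_le2)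
    then show "q \<sqsubseteq> \<sim>?x \<squnion> \<c>"
      using x join_centre_mono[of "\<sim>?y" "\<sim>?x"] by (simp add: y')
  qed (use x in simp_all)
  ultimately show "?x \<squnion> \<c> = p \<and> \<sim>?x \<squnion> \<c> = q" ..
qed

lemma beta_fn_in_carrier:
  "x \<in> carrier T \<Longrightarrow> UPair (x \<squnion> \<c>) (\<sim>x \<squnion> \<c>) \<in> carrier (K_obj (C_obj T))"
  by (simp add: joins_meet)

lemma beta_bij: "bij_betw (fn (\<beta> T)) (carrier T) (carrier (K_obj (C_obj T)))"
  unfolding bij_betw_def
proof
  show "inj_on (fn (\<beta> T)) (carrier T)"
    by (auto simp: \<beta>_def inj_on_def intro: eq_iff_joins)
  show "fn (\<beta> T) ` carrier T = carrier (K_obj (C_obj T))"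
  proof
    show "fn (\<beta> T) ` carrier T \<subseteq> carrier (K_obj (C_obj T))"
      using beta_fn_in_carrier by (auto simp: \<beta>_def)
    show "carrier (K_obj (C_obj T)) \<subseteq> fn (\<beta> T) ` carrier T"
    proof
      fix z assume "z \<in> carrier (K_obj (C_obj T))"
      then obtain p q where "z = UPair p q" "p \<in> carrier T" "q \<in> carrier T" "\<c> \<sqsubseteq> p" "\<c> \<sqsubseteq> q"
        "p \<sqinter> q = \<c>"
        by (auto elim!: C.K_cases)
      then show "z \<in> fn (\<beta> T) ` carrier T"
        using exists_joins[of p q] by (force simp: \<beta>_def)
    qed
  qed
qed

text \<open>This is \<open>le_iff_joins\<close> in coordinates. The direction from images to
  arguments is what makes the inverse of \<beta> monotone.\<close>

lemma beta_le_iff: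
  "\<lbrakk>x \<in> carrier T; y \<in> carrier T\<rbrakk> \<Longrightarrow>
    fn (\<beta> T) x \<sqsubseteq>\<^bsub>K_obj (C_obj T)\<^esub> fn (\<beta> T) y \<longleftrightarrow> x \<sqsubseteq> y"
  by (simp add: \<beta>_def C_le_iff flip: le_iff_joins)

lemma beta_imp:
  "\<lbrakk>x \<in> carrier T; y \<in> carrier T\<rbrakk> \<Longrightarrow>
    fn (\<beta> T) (x \<leadsto> y) = fn (\<beta> T) x \<leadsto>\<^bsub>K_obj (C_obj T)\<^esub> fn (\<beta> T) y"
  by (simp add: \<beta>_def imp_join_centre neg_imp_join_centre)

lemma beta_ge_centre: "\<lbrakk>\<c> \<sqsubseteq> x; x \<in> carrier T\<rbrakk> \<Longrightarrow> fn (\<beta> T) x = UPair x \<c>"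
  by (simp add: \<beta>_def join_centre_absorb join_centre_absorb' neg_le_centre_iff)

lemma beta_hom: "khis_hom T (K_obj (C_obj T)) (fn (\<beta> T))"
  unfolding khis_hom_def
proof (intro conjI ballI impI, goal_cases)
  case (1 x y) then show ?case by (simp add: beta_le_iff)
next
  case (2 x) then show ?case by (simp add: \<beta>_def)
next
  case (3 x y) then show ?case by (rule beta_imp)
next
  case (4 x y) then show ?case
    using C.K_meet[of x y \<c>] C.meet_zero[of y]
    by (simp add: beta_ge_centre meet_closed' centre_le_meet)
qed

lemma beta_khis0_hom: "khis0_hom T (K_obj (C_obj T)) (fn (\<beta> T))"
  using C.khis0_K beta_hom bij_betwE[OF beta_bij] khis0_axioms
  by (simp add: khis0_hom_def khis0_hom_axioms_def)

lemma beta_iso: "iso_arrow KIS0 (\<beta> T)"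
proof -
  have src_tgt: "src (\<beta> T) = T" "tgt (\<beta> T) = K_obj (C_obj T)"
    by (simp_all add: \<beta>_def)
  have "fn (\<beta> T) \<in> carrier T \<rightarrow>\<^sub>E carrier (K_obj (C_obj T))"
    using bij_betwE[OF beta_bij] by (auto simp: \<beta>_def)
  then have "\<beta> T \<in> Arr KIS0"
    using beta_hom C.kis0_K kis0_axioms by (simp add: Arr_KIS0_iff src_tgt)
  then show ?thesis
    unfolding KIS0_eq
    using beta_bij khis0_hom.khis_hom_inv[OF beta_khis0_hom beta_bij] beta_le_iff
    by (intro iso_arrow_concrete_catI) (simp_all add: src_tgt)
qed

text \<open>The identity holds for pairs, and injectivity of \<beta> brings it back to
  \<open>T\<close>. That \<beta> respects the join with the centre is seen directly: both sides are
  \<open>UPair (x \<squnion> \<c>) \<c>\<close>.\<close>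

lemma join_centre_eq_imp:
  assumes "x \<in> carrier T"
  shows "x \<squnion> \<c> = (\<c> \<leadsto> x) \<leadsto> x"
proof -
  let ?K = "K_obj (C_obj T)"
  have centre: "fn (\<beta> T) \<c> = \<c>\<^bsub>?K\<^esub>"
    by (simp add: beta_ge_centre)
  have carr: "fn (\<beta> T) x \<in> carrier ?K"
    using bij_betwE[OF beta_bij] assms by blast
  have "fn (\<beta> T) (x \<squnion> \<c>) = UPair (x \<squnion> \<c>) \<c>"
    using assms by (simp add: beta_ge_centre)
  also have "\<dots> = fn (\<beta> T) x \<squnion>\<^bsub>?K\<^esub> \<c>\<^bsub>?K\<^esub>"
    using assms C.K_join_centre[OF beta_fn_in_carrier[OF assms]] by (simp add: \<beta>_def)
  also have "\<dots> = fn (\<beta> T) ((\<c> \<leadsto> x) \<leadsto> x)"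
    using assms carr by (simp add: beta_imp centre C.K_join_centre_eq_imp del: C.K_centre)
  finally show ?thesis
    using assms beta_bij by (auto simp: bij_betw_def dest!: inj_onD)
qed

end

lemma univ_kis0_iff [simp]: "univ_kis0 T \<longleftrightarrow> kis0 T"
  by (simp add: univ_kis0_def)

lemma natural_alpha:
  "natural_isomorphism IS0 IS0 id_functor (comp_functor C_functor K_functor) \<alpha>"
proof (intro natural_isomorphism.intro natural_transformation.intro
    natural_transformation_axioms.intro natural_isomorphism_axioms.intro
    cat_functor_id cat_functor_comp[OF functor_K functor_C] category_IS0)
  fix H :: "'a univ isl" assume H: "H \<in> Obj IS0"
  then show "iso_arrow IS0 (\<alpha> H)" by (simp add: univ_isl.alpha_iso)
  then show "\<alpha> H \<in> Arr IS0" by (simp add: iso_arrow_def)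
  show "Dom IS0 (\<alpha> H) = OMap id_functor H"
    and "Cod IS0 (\<alpha> H) = OMap (comp_functor C_functor K_functor) H"
    by (simp_all add: \<alpha>_def id_functor_def comp_functor_def C_functor_def K_functor_def)
next
  fix f :: "('a univ isl, 'a univ) arrow" assume "f \<in> Arr IS0"
  \<comment> \<open>Preservation of zero is what naturality of \<alpha> comes down to: the second
    coordinates compared are the image of zero and zero.\<close>
  then have f: "fn f \<in> carrier (src f) \<rightarrow>\<^sub>E carrier (tgt f)" "fn f (izero (src f)) = izero (tgt f)"
    and "bounded_implicative_semilattice (src f)"
    by (auto simp: Arr_IS0_iff isl_hom_def)
  then interpret univ_isl "src f" by simp
  interpret K: kis0 "K_obj (src f)" by (rule kis0_K)
  show "Comp IS0 (\<alpha> (Cod IS0 f)) (AMap id_functor f) =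
      Comp IS0 (AMap (comp_functor C_functor K_functor) f) (\<alpha> (Dom IS0 f))"
    using f by (auto simp: \<alpha>_def id_functor_def comp_functor_def C_functor_def K_functor_def
        C_arr_def K_arr_def compose_def fun_eq_iff PiE_iff closed meet_zero zero_least refl)
qed

lemma natural_beta:
  "natural_isomorphism KIS0 KIS0 id_functor (comp_functor K_functor C_functor) \<beta>"
proof (intro natural_isomorphism.intro natural_transformation.intro
    natural_transformation_axioms.intro natural_isomorphism_axioms.intro
    cat_functor_id cat_functor_comp[OF functor_C functor_K] category_KIS0)
  fix T :: "'a univ khis" assume T: "T \<in> Obj KIS0"
  then show "iso_arrow KIS0 (\<beta> T)" by (simp add: univ_kis0.beta_iso)
  then show "\<beta> T \<in> Arr KIS0" by (simp add: iso_arrow_def)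
  show "Dom KIS0 (\<beta> T) = OMap id_functor T"
    and "Cod KIS0 (\<beta> T) = OMap (comp_functor K_functor C_functor) T"
    by (simp_all add: \<beta>_def id_functor_def comp_functor_def C_functor_def K_functor_def)
next
  fix g :: "('a univ khis, 'a univ) arrow" assume g: "g \<in> Arr KIS0"
  interpret g: khis0_hom "src g" "tgt g" "fn g" using g by (rule khis0_hom_if_Arr)
  interpret S: univ_kis0 "src g" using g by (simp add: Arr_KIS0_iff)
  interpret T: univ_kis0 "tgt g" using g by (simp add: Arr_KIS0_iff)
  \<comment> \<open>Both coordinates of \<beta> are joins with the centre. Rewritten as terms in ->
    and the centre, they commute with every morphism.\<close>
  have join: "fn g (x \<squnion>\<^bsub>src g\<^esub> \<c>\<^bsub>src g\<^esub>) = fn g x \<squnion>\<^bsub>tgt g\<^esub> \<c>\<^bsub>tgt g\<^esub>" if "x \<in> carrier (src g)" for x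
    using that
    by (simp add: S.join_centre_eq_imp T.join_centre_eq_imp g.maps g.hom_imp g.hom_centre)
  show "Comp KIS0 (\<beta> (Cod KIS0 g)) (AMap id_functor g) =
      Comp KIS0 (AMap (comp_functor K_functor C_functor) g) (\<beta> (Dom KIS0 g))"
    by (auto simp: \<beta>_def id_functor_def comp_functor_def C_functor_def K_functor_def
        C_arr_def K_arr_def compose_def fun_eq_iff S.joins_meet join g.maps g.hom_neg)
qed

theorem corollary47:
  shows "category_equivalence
           (IS0 :: ('a univ isl, ('a univ isl, 'a univ) arrow) cat_data)
           (KIS0 :: ('a univ khis, ('a univ khis, 'a univ) arrow) cat_data)
           K_functor C_functor \<alpha> \<beta>"
  by (intro category_equivalence.intro functor_K functor_C natural_alpha natural_beta)

end
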